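(* Let $Y$ be the set of all standard strings of subsets of $\{1,\dots,n\}$. Then $r(Y)=\{r(\mathcal B)\mid \mathcal B\in Y\}$ is a basis for $Q_n$.
   Context: Let $k$ be a field and $n\ge 1$. $Q_n$ is the associative unital $k$-algebra with generators $z_{A,i}$, for $A\subseteq\{1,\dots,n\}$ and $i\in\{1,\dots,n\}\setminus A$, and defining relations $$z_{A\cup\{i\},j}+z_{A,i}=z_{A\cup\{j\},i}+z_{A,j},\qquad z_{A\cup\{i\},j}\,z_{A,i}=z_{A\cup\{j\},i}\,z_{A,j}$$ for all $A$ and all distinct $i,j\notin A$. For $A=\{c_1,\dots,c_u\}$ put $r(A)=z_{\emptyset,c_1}+z_{\{c_1\},c_2}+\dots+z_{\{c_1,\dots,c_{u-1}\},c_u}$, which does not depend on the ordering of $A$. A string is a finite (possibly empty) sequence $\mathcal B=(B_1,\dots,B_l)$ of nonempty subsets of $\{1,\dots,n\}$; $r(\mathcal B)=r(B_1)\cdots r(B_l)\in Q_n$, with $r$ of the empty string equal to $1$. For $0\le i\le l$, $T_i(\mathcal B)=(B_{i+1},\dots,B_l)$. The skeleton of $\mathcal B$ is the sequence $n(\mathcal B)=(n_1,\dots,n_t)$ with $n_1=1$, $$n_{q+1}=\min\big(\{j>n_q \mid B_j\not\subseteq B_{n_q}\ \text{or}\ |B_j|\ne |B_{n_q}|+n_q-j\}\cup\{l+1\}\big),$$ where $t$ is the smallest index with $n_t=l+1$. For $B\subseteq\{1,\dots,n\}$ and a string $\mathcal C=(C_1,\dots,C_m)$, put $e(B,\mathcal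 C)=\max(B)$ if $m\ge1$ and $C_1=B\setminus\{b\}$ for some $b\in B$, and $e(B,\mathcal C)=0$ otherwise. A string $\mathcal B$ with skeleton $(n_1,\dots,n_t)$ is standard if $B_{i+1}=B_i\setminus\{e(B_i,T_i(\mathcal B))\}$ whenever $1\le j<t$ and $n_j<i+1<n_{j+1}$. *)

theory Defs
  imports
    "HOL-Algebra.QuotRing"
    "HOL-Library.Poly_Mapping"
    "Jordan_Normal_Form.VS_Connect"
begin

hide_const (open) Multiset.mult Polynomial.smult Modules.module

text \<open>
  The free monoid on a type of letters, written additively so that finitely supported
  functions on it form, under convolution, the free associative algebra.
\<close>

datatype 'a fword = Fword (letters: "'a list")

instantiation fword :: (type) monoid_add
begin
definition zero_fword :: "'a fword" where
  "zero_fword = Fword []"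
definition plus_fword :: "'a fword \<Rightarrow> 'a fword \<Rightarrow> 'a fword" where
  "plus_fword v w = Fword (letters v @ letters w)"
instance
  by standard (simp_all add: zero_fword_def plus_fword_def)
end

lemma letters_zero [simp]: "letters 0 = []"
  by (simp add: zero_fword_def)

lemma letters_plus [simp]: "letters (v + w) = letters v @ letters w"
  by (simp add: plus_fword_def)

text \<open>The pair \<open>(A, i)\<close> stands for the generator \<open>z\<^bsub>A,i\<^esub>\<close>.\<close>

type_synonym gen = "nat set \<times> nat"

type_synonym 'k free = "gen fword \<Rightarrow>\<^sub>0 'k"

definition gens :: "nat \<Rightarrow> gen set" where
  "gens n = {(A, i). A \<subseteq> {1..n} \<and> i \<in> {1..n} - A}"

definition free_alg :: "nat \<Rightarrow> ('k::field) free ring" where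
  "free_alg n =
    \<lparr>carrier = {p. \<forall>w \<in> Poly_Mapping.keys p. set (letters w) \<subseteq> gens n},
     mult = (*), one = 1, zero = 0, add = (+)\<rparr>"

definition zfree :: "nat set \<Rightarrow> nat \<Rightarrow> ('k::field) free" where
  "zfree A i = Poly_Mapping.single (Fword [(A, i)]) 1"

definition const_free :: "'k::field \<Rightarrow> 'k free" where
  "const_free c = Poly_Mapping.single 0 c"

definition Q_rels :: "nat \<Rightarrow> ('k::field) free set" where
  "Q_rels n =
    {(zfree (A \<union> {i}) j + zfree A i) - (zfree (A \<union> {j}) i + zfree A j) | A i j.
       A \<subseteq> {1..n} \<and> i \<in> {1..n} - A \<and> j \<in> {1..n} - A \<and> i \<noteq> j} \<union>
    {zfree (A \<union> {i}) j * zfree A i - zfree (A \<union> {j}) i * zfree A j | A i j.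
       A \<subseteq> {1..n} \<and> i \<in> {1..n} - A \<and> j \<in> {1..n} - A \<and> i \<noteq> j}"

definition Q_ideal :: "nat \<Rightarrow> ('k::field) free set" where
  "Q_ideal n = Idl\<^bsub>free_alg n\<^esub> (Q_rels n)"

definition Q_ring :: "nat \<Rightarrow> ('k::field) free set ring" where
  "Q_ring n = free_alg n Quot Q_ideal n"

text \<open>Scalar multiplication by \<open>c\<close> is multiplication by the class of the constant \<open>c\<close>.\<close>

definition Q_alg :: "nat \<Rightarrow> ('k::field, 'k free set) module" where
  "Q_alg n =
    \<lparr>carrier = carrier (Q_ring n), mult = mult (Q_ring n), one = one (Q_ring n),
     zero = zero (Q_ring n), add = add (Q_ring n),
     smult = (\<lambda>c x. (Q_ideal n +>\<^bsub>free_alg n\<^esub> const_free c) \<otimes>\<^bsub>Q_ring n\<^esub> x)\<rparr>"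

definition zQ :: "nat \<Rightarrow> nat set \<Rightarrow> nat \<Rightarrow> ('k::field) free set" where
  "zQ n A i = Q_ideal n +>\<^bsub>free_alg n\<^esub> zfree A i"

text \<open>
  \<open>r_ord n [c\<^sub>1, \<dots>, c\<^sub>u]\<close> is the sum defining \<open>r {c\<^sub>1, \<dots>, c\<^sub>u}\<close> for this enumeration of
  the set; \<open>r_ord_eq_r_set\<close> below shows that the enumeration does not matter, so
  \<open>r_set\<close> may use the increasing one.
\<close>

definition r_ord :: "nat \<Rightarrow> nat list \<Rightarrow> ('k::field) free set" where
  "r_ord n cs =
    (\<Oplus>\<^bsub>Q_alg n :: ('k, 'k free set) module\<^esub> v \<in> {..<length cs}. zQ n (set (take v cs)) (cs ! v))"

definition r_set :: "nat \<Rightarrow> nat set \<Rightarrow> ('k::field) free set" where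
  "r_set n A = r_ord n (sorted_list_of_set A)"

definition r_str :: "nat \<Rightarrow> nat set list \<Rightarrow> ('k::field) free set" where
  "r_str n Bs = foldr (mult (Q_alg n :: ('k, 'k free set) module)) (map (r_set n) Bs)
                  (one (Q_alg n :: ('k, 'k free set) module))"

text \<open>
  Strings are indexed from 1, as in \<open>(B\<^sub>1, \<dots>, B\<^sub>l)\<close>.
\<close>

abbreviation entry :: "nat set list \<Rightarrow> nat \<Rightarrow> nat set" where
  "entry Bs j \<equiv> Bs ! (j - 1)"

definition is_string :: "nat \<Rightarrow> nat set list \<Rightarrow> bool" where
  "is_string n Bs \<longleftrightarrow> (\<forall>B \<in> set Bs. B \<noteq> {} \<and> B \<subseteq> {1..n})"

text \<open>The difference of cardinality and position may be negative, hence the integers.\<close>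

definition next_skel :: "nat set list \<Rightarrow> nat \<Rightarrow> nat" where
  "next_skel Bs m =
    Min ({j. m < j \<and> j \<le> length Bs \<and>
            (\<not> entry Bs j \<subseteq> entry Bs m \<or>
             int (card (entry Bs j)) \<noteq> int (card (entry Bs m)) + int m - int j)}
         \<union> {length Bs + 1})"

text \<open>
  \<open>skel_seq Bs q\<close> is \<open>n\<^bsub>q+1\<^esub>\<close>.  The skeleton is its initial segment up to the first
  occurrence of \<open>l + 1\<close>.
\<close>

primrec skel_seq :: "nat set list \<Rightarrow> nat \<Rightarrow> nat" where
  "skel_seq Bs 0 = 1"
| "skel_seq Bs (Suc q) = next_skel Bs (skel_seq Bs q)"

definition skeleton :: "nat set list \<Rightarrow> nat list" where
  "skeleton Bs = map (skel_seq Bs) [0..<Suc (LEAST q. skel_seq Bs q = length Bs + 1)]"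

definition e_str :: "nat set \<Rightarrow> nat set list \<Rightarrow> nat" where
  "e_str B Cs = (if Cs \<noteq> [] \<and> (\<exists>b \<in> B. hd Cs = B - {b}) then Max B else 0)"

definition is_standard :: "nat set list \<Rightarrow> bool" where
  "is_standard Bs \<longleftrightarrow>
    (\<forall>q i. Suc q < length (skeleton Bs) \<longrightarrow>
       skeleton Bs ! q < i + 1 \<longrightarrow> i + 1 < skeleton Bs ! Suc q \<longrightarrow>
       entry Bs (i + 1) = entry Bs i - {e_str (entry Bs i) (drop i Bs)})"

definition std_strings :: "nat \<Rightarrow> nat set list set" where
  "std_strings n = {Bs. is_string n Bs \<and> is_standard Bs}"

lemma free_alg_simps [simp]:
  "mult (free_alg n) = (*)" "one (free_alg n) = 1"
  "zero (free_alg n) = 0" "add (free_alg n) = (+)"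
  by (simp_all add: free_alg_def)

lemma free_alg_carrier:
  "p \<in> carrier (free_alg n) \<longleftrightarrow> (\<forall>w \<in> Poly_Mapping.keys p. set (letters w) \<subseteq> gens n)"
  by (simp add: free_alg_def)

lemma free_alg_closed:
  fixes p q :: "('k::field) free"
  assumes "p \<in> carrier (free_alg n)" "q \<in> carrier (free_alg n)"
  shows "p + q \<in> carrier (free_alg n)" "p * q \<in> carrier (free_alg n)"
    "- p \<in> carrier (free_alg n)" "p - q \<in> carrier (free_alg n)"
proof -
  have add: "p + q \<in> carrier (free_alg n)" if "p \<in> carrier (free_alg n)"
    "q \<in> carrier (free_alg n)" for p q :: "'k free"
    using that keys_add[of p q] by (force simp: free_alg_carrier)
  have neg: "- p \<in> carrier (free_alg n)" if "p \<in> carrier (free_alg n)" for p :: "'k free"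
    using that by (simp add: free_alg_carrier)
  show "p + q \<in> carrier (free_alg n)" "- p \<in> carrier (free_alg n)"
    using assms add neg by blast+
  show "p - q \<in> carrier (free_alg n)"
    using add[OF assms(1) neg[OF assms(2)]] by simp
  show "p * q \<in> carrier (free_alg n)"
    unfolding free_alg_carrier
  proof
    fix w assume "w \<in> Poly_Mapping.keys (p * q)"
    then obtain u v where "u \<in> Poly_Mapping.keys p" "v \<in> Poly_Mapping.keys q" "w = u + v"
      using keys_mult[of p q] by blast
    then show "set (letters w) \<subseteq> gens n"
      using assms by (auto simp: free_alg_carrier)
  qed
qed

lemma free_alg_ring: "ring (free_alg n :: ('k::field) free ring)"
proof (rule ringI)
  show "abelian_group (free_alg n :: 'k free ring)"
  proof (rule abelian_groupI)
    fix x :: "'k free"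
    assume x: "x \<in> carrier (free_alg n)"
    show "\<exists>y\<in>carrier (free_alg n). y \<oplus>\<^bsub>free_alg n\<^esub> x = \<zero>\<^bsub>free_alg n\<^esub>"
      using free_alg_closed(3)[OF x x] by (intro bexI[of _ "- x"]) simp_all
  qed (simp_all add: free_alg_closed add.assoc add.commute, simp add: free_alg_carrier)
  show "Group.monoid (free_alg n :: 'k free ring)"
    by (rule monoidI) (simp_all add: free_alg_closed mult.assoc, simp add: free_alg_carrier)
qed (simp_all add: algebra_simps)

lemma zfree_closed:
  "(A, i) \<in> gens n \<Longrightarrow> (zfree A i :: ('k::field) free) \<in> carrier (free_alg n)"
  by (simp add: free_alg_carrier zfree_def)

lemma const_free_closed: "const_free c \<in> carrier (free_alg n)"
  by (simp add: free_alg_carrier const_free_def)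

lemma Q_rels_closed: "(Q_rels n :: ('k::field) free set) \<subseteq> carrier (free_alg n)"
  unfolding Q_rels_def
  by (auto intro!: free_alg_closed zfree_closed simp: gens_def)

lemma Q_ideal_ideal: "ideal (Q_ideal n :: ('k::field) free set) (free_alg n)"
  unfolding Q_ideal_def
  by (rule ring.genideal_ideal[OF free_alg_ring Q_rels_closed])

lemma Q_ring_ring: "ring (Q_ring n :: ('k::field) free set ring)"
  unfolding Q_ring_def by (rule ideal.quotient_is_ring[OF Q_ideal_ideal])

lemma Q_simps [simp]:
  "carrier (Q_alg n) = carrier (Q_ring n)" "mult (Q_alg n) = mult (Q_ring n)"
  "one (Q_alg n) = one (Q_ring n)" "zero (Q_alg n) = zero (Q_ring n)" "add (Q_alg n) = add (Q_ring n)"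
  "smult (Q_alg n) c x = (Q_ideal n +>\<^bsub>free_alg n\<^esub> const_free c) \<otimes>\<^bsub>Q_ring n\<^esub> x"
  by (simp_all add: Q_alg_def)

lemma Q_is_ring: "ring (Q_alg n :: ('k::field, 'k free set) module)"
proof -
  interpret R: ring "Q_ring n :: 'k free set ring" by (rule Q_ring_ring)
  show ?thesis
  proof (rule ringI)
    show "abelian_group (Q_alg n :: ('k, 'k free set) module)"
    proof (rule abelian_groupI)
      fix x assume "x \<in> carrier (Q_alg n :: ('k, 'k free set) module)"
      then show "\<exists>y\<in>carrier (Q_alg n :: ('k, 'k free set) module). y \<oplus>\<^bsub>Q_alg n\<^esub> x = \<zero>\<^bsub>Q_alg n\<^esub>"
        using R.l_neg R.a_inv_closed by auto
    qed (simp_all add: R.a_ac)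
    show "Group.monoid (Q_alg n :: ('k, 'k free set) module)"
      by (rule monoidI) (simp_all add: R.m_assoc)
  qed (simp_all add: R.l_distr R.r_distr)
qed

lemma quot_hom:
  "(\<lambda>x. Q_ideal n +>\<^bsub>free_alg n\<^esub> x)
     \<in> Ring.ring_hom (free_alg n :: ('k::field) free ring) (Q_ring n)"
  unfolding Q_ring_def by (rule ideal.rcos_ring_hom[OF Q_ideal_ideal])

lemma Q_ring_carrier:
  "carrier (Q_ring n :: ('k::field) free set ring)
     = (\<lambda>p. Q_ideal n +>\<^bsub>free_alg n\<^esub> p) ` carrier (free_alg n)"
  by (auto simp: Q_ring_def FactRing_def A_RCOSETS_def')

lemma const_free_hom:
  "const_free (a + b) = const_free a + const_free b"
  "const_free (a * b) = const_free a * const_free b"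
  "const_free 1 = 1"
  by (simp_all add: const_free_def single_add mult_single)

lemma const_free_central: "const_free c * p = p * const_free c"
proof (induction p rule: Poly_Mapping.update_induct)
  case const
  show ?case by simp
next
  case (update p w a)
  have "Poly_Mapping.update w a p = p + Poly_Mapping.single w a"
    using update.hyps
    by (intro poly_mapping_eqI)
      (auto simp: lookup_update lookup_add lookup_single when_def in_keys_iff)
  moreover have "const_free c * Poly_Mapping.single w a = Poly_Mapping.single w a * const_free c"
    by (simp add: const_free_def mult_single mult.commute)
  ultimately show ?case
    using update.IH by (simp add: algebra_simps)
qed

lemma Q_vectorspace:
  "vectorspace (class_ring :: 'k::field ring) (Q_alg n :: ('k, 'k free set) module)"
proof -
  interpret R: ring "Q_ring n :: 'k free set ring" by (rule Q_ring_ring)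
  note hom = quot_hom[where 'k = 'k and n = n]
  note closed = ring_hom_closed[OF hom const_free_closed]
  have add: "Q_ideal n +>\<^bsub>free_alg n\<^esub> const_free (a + b)
      = (Q_ideal n +>\<^bsub>free_alg n\<^esub> const_free a) \<oplus>\<^bsub>Q_ring n\<^esub> (Q_ideal n +>\<^bsub>free_alg n\<^esub> const_free b)"
    for a b :: 'k
    using ring_hom_add[OF hom const_free_closed const_free_closed] by (simp add: const_free_hom)
  have mult: "Q_ideal n +>\<^bsub>free_alg n\<^esub> const_free (a * b)
      = (Q_ideal n +>\<^bsub>free_alg n\<^esub> const_free a) \<otimes>\<^bsub>Q_ring n\<^esub> (Q_ideal n +>\<^bsub>free_alg n\<^esub> const_free b)"
    for a b :: 'k
    using ring_hom_mult[OF hom const_free_closed const_free_closed] by (simp add: const_free_hom)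
  have one: "Q_ideal n +>\<^bsub>free_alg n\<^esub> const_free (1::'k) = \<one>\<^bsub>Q_ring n\<^esub>"
    using ring_hom_one[OF hom] by (simp add: const_free_hom)
  have "cring (class_ring :: 'k ring)"
    by (rule class_cring.cring_axioms)
  moreover have "abelian_group (Q_alg n :: ('k, 'k free set) module)"
    using Q_is_ring ring.is_abelian_group by blast
  ultimately have "Module.module (class_ring :: 'k ring) (Q_alg n :: ('k, 'k free set) module)"
    by (rule moduleI) (use closed in \<open>simp_all add: add mult one R.l_distr R.r_distr R.m_assoc\<close>)
  then show ?thesis
    unfolding vectorspace_def using class_field by blast
qed

lemma Q_smult_mult:
  fixes x y :: "('k::field) free set"
  assumes "x \<in> carrier (Q_alg n)" "y \<in> carrier (Q_alg n)"
  shows "c \<odot>\<^bsub>Q_alg n\<^esub> (x \<otimes>\<^bsub>Q_alg n\<^esub> y) = (c \<odot>\<^bsub>Q_alg n\<^esub> x) \<otimes>\<^bsub>Q_alg n\<^esub> y"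
    "c \<odot>\<^bsub>Q_alg n\<^esub> (x \<otimes>\<^bsub>Q_alg n\<^esub> y) = x \<otimes>\<^bsub>Q_alg n\<^esub> (c \<odot>\<^bsub>Q_alg n\<^esub> y)"
proof -
  interpret R: ring "Q_ring n :: 'k free set ring" by (rule Q_ring_ring)
  note hom = quot_hom[where 'k = 'k and n = n]
  let ?c = "Q_ideal n +>\<^bsub>free_alg n\<^esub> const_free c"
  have c: "?c \<in> carrier (Q_ring n)"
    by (rule ring_hom_closed[OF hom const_free_closed])
  obtain p where p: "p \<in> carrier (free_alg n)" "x = Q_ideal n +>\<^bsub>free_alg n\<^esub> p"
    using assms(1) by (auto simp: Q_ring_carrier)
  have "?c \<otimes>\<^bsub>Q_ring n\<^esub> x = x \<otimes>\<^bsub>Q_ring n\<^esub> ?c"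
    using ring_hom_mult[OF hom const_free_closed p(1)] ring_hom_mult[OF hom p(1) const_free_closed]
    by (simp add: p(2) const_free_central)
  then show "c \<odot>\<^bsub>Q_alg n\<^esub> (x \<otimes>\<^bsub>Q_alg n\<^esub> y) = (c \<odot>\<^bsub>Q_alg n\<^esub> x) \<otimes>\<^bsub>Q_alg n\<^esub> y"
    "c \<odot>\<^bsub>Q_alg n\<^esub> (x \<otimes>\<^bsub>Q_alg n\<^esub> y) = x \<otimes>\<^bsub>Q_alg n\<^esub> (c \<odot>\<^bsub>Q_alg n\<^esub> y)"
    using assms c by (simp_all flip: R.m_assoc)
qed

lemma z_closed: "(A, i) \<in> gens n \<Longrightarrow> zQ n A i \<in> carrier (Q_alg n)"
  unfolding zQ_def Q_simps by (rule ring_hom_closed[OF quot_hom zfree_closed])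

lemma quot_eqI:
  fixes p q :: "('k::field) free"
  assumes "p \<in> carrier (free_alg n)" "q \<in> carrier (free_alg n)" "p - q \<in> Q_ideal n"
  shows "Q_ideal n +>\<^bsub>free_alg n\<^esub> p = Q_ideal n +>\<^bsub>free_alg n\<^esub> q"
proof -
  interpret I: ideal "Q_ideal n :: 'k free set" "free_alg n" by (rule Q_ideal_ideal)
  have "p = (p - q) \<oplus>\<^bsub>free_alg n\<^esub> q" by simp
  then have "p \<in> Q_ideal n +>\<^bsub>free_alg n\<^esub> q"
    using assms(3) unfolding a_r_coset_def' by blast
  then show ?thesis
    using I.a_repr_independence[OF _ assms(2)] I.a_subgroup by blast
qed

lemma z_rels:
  assumes "A \<subseteq> {1..n}" "i \<in> {1..n} - A" "j \<in> {1..n} - A" "i \<noteq> j"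
  shows
    "zQ n (A \<union> {i}) j \<oplus>\<^bsub>Q_alg n\<^esub> zQ n A i
       = (zQ n (A \<union> {j}) i \<oplus>\<^bsub>Q_alg n\<^esub> zQ n A j :: ('k::field) free set)"
    "zQ n (A \<union> {i}) j \<otimes>\<^bsub>Q_alg n\<^esub> zQ n A i
       = (zQ n (A \<union> {j}) i \<otimes>\<^bsub>Q_alg n\<^esub> zQ n A j :: ('k::field) free set)"
proof -
  note hom = quot_hom[where 'k = 'k and n = n]
  have g: "(A \<union> {i}, j) \<in> gens n" "(A, i) \<in> gens n" "(A \<union> {j}, i) \<in> gens n" "(A, j) \<in> gens n"
    using assms by (auto simp: gens_def)
  note c = g(1)[THEN zfree_closed[where 'k = 'k]] g(2)[THEN zfree_closed[where 'k = 'k]]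
    g(3)[THEN zfree_closed[where 'k = 'k]] g(4)[THEN zfree_closed[where 'k = 'k]]
  have sub: "Q_rels n \<subseteq> (Q_ideal n :: 'k free set)"
    unfolding Q_ideal_def by (rule ring.genideal_self[OF free_alg_ring Q_rels_closed])
  have "(zfree (A \<union> {i}) j + zfree A i) - (zfree (A \<union> {j}) i + zfree A j)
      \<in> (Q_ideal n :: 'k free set)"
    by (rule subsetD[OF sub]) (use assms in \<open>unfold Q_rels_def, blast\<close>)
  from quot_eqI[OF _ _ this] show "zQ n (A \<union> {i}) j \<oplus>\<^bsub>Q_alg n\<^esub> zQ n A i
       = (zQ n (A \<union> {j}) i \<oplus>\<^bsub>Q_alg n\<^esub> zQ n A j :: 'k free set)"
    using ring_hom_add[OF hom c(1,2)] ring_hom_add[OF hom c(3,4)] c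
    by (simp add: zQ_def free_alg_closed)
  have "zfree (A \<union> {i}) j * zfree A i - zfree (A \<union> {j}) i * zfree A j
      \<in> (Q_ideal n :: 'k free set)"
    by (rule subsetD[OF sub]) (use assms in \<open>unfold Q_rels_def, blast\<close>)
  from quot_eqI[OF _ _ this] show "zQ n (A \<union> {i}) j \<otimes>\<^bsub>Q_alg n\<^esub> zQ n A i
       = (zQ n (A \<union> {j}) i \<otimes>\<^bsub>Q_alg n\<^esub> zQ n A j :: 'k free set)"
    using ring_hom_mult[OF hom c(1,2)] ring_hom_mult[OF hom c(3,4)] c
    by (simp add: zQ_def free_alg_closed)
qed

lemma r_ord_term_closed:
  assumes "distinct cs" "set cs \<subseteq> {1..n}" "v < length cs"
  shows "zQ n (set (take v cs)) (cs ! v) \<in> carrier (Q_alg n)"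
proof (rule z_closed)
  have "cs ! v \<notin> set (take v cs)"
    using assms by (auto simp: in_set_conv_nth nth_eq_iff_index_eq)
  then show "(set (take v cs), cs ! v) \<in> gens n"
    using assms(2) set_take_subset[of v cs] nth_mem[OF assms(3)]
    unfolding gens_def by blast
qed

lemma r_ord_closed:
  assumes "distinct cs" "set cs \<subseteq> {1..n}"
  shows "(r_ord n cs :: ('k::field) free set) \<in> carrier (Q_alg n)"
proof -
  interpret R: ring "Q_alg n :: ('k, 'k free set) module" by (rule Q_is_ring)
  show ?thesis
    unfolding r_ord_def by (rule R.finsum_closed) (use r_ord_term_closed[OF assms] in auto)
qed

lemma r_ord_snoc:
  assumes "distinct (cs @ [c])" "set (cs @ [c]) \<subseteq> {1..n}"
  shows "(r_ord n (cs @ [c]) :: ('k::field) free set) = zQ n (set cs) c \<oplus>\<^bsub>Q_alg n\<^esub> r_ord n cs"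
proof -
  interpret R: ring "Q_alg n :: ('k, 'k free set) module" by (rule Q_is_ring)
  let ?f = "\<lambda>v. zQ n (set (take v (cs @ [c]))) ((cs @ [c]) ! v) :: 'k free set"
  have cl: "?f v \<in> carrier (Q_alg n)" if "v < Suc (length cs)" for v
    using r_ord_term_closed[OF assms, of v] that by simp
  have "(r_ord n (cs @ [c]) :: 'k free set)
      = (\<Oplus>\<^bsub>Q_alg n\<^esub> v \<in> insert (length cs) {..<length cs}. ?f v)"
    by (simp add: r_ord_def lessThan_Suc)
  also have "\<dots> = ?f (length cs) \<oplus>\<^bsub>Q_alg n\<^esub> (\<Oplus>\<^bsub>Q_alg n\<^esub> v \<in> {..<length cs}. ?f v)"
    by (rule R.finsum_insert)
      (use cl cl[of "length cs"] in \<open>auto simp del: Q_simps\<close>)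
  also have "(\<Oplus>\<^bsub>Q_alg n\<^esub> v \<in> {..<length cs}. ?f v) = r_ord n cs"
    unfolding r_ord_def
    by (rule R.finsum_cong')
      (use r_ord_term_closed[of cs n] assms in \<open>auto simp: nth_append\<close>)
  finally show ?thesis by simp
qed

lemma r_ord_indep:
  assumes "distinct cs" "distinct ds" "set cs = set ds" "set cs \<subseteq> {1..n}"
  shows "(r_ord n cs :: ('k::field) free set) = r_ord n ds"
  using assms
proof (induction "length cs" arbitrary: cs ds rule: less_induct)
  case less
  interpret R: ring "Q_alg n :: ('k, 'k free set) module" by (rule Q_is_ring)
  show ?case
  proof (cases cs rule: rev_cases)
    case Nil
    then show ?thesis using less.prems by simp
  next
    case cs: (snoc cs' i)
    then obtain ds' j where ds: "ds = ds' @ [j]"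
      using less.prems by (cases ds rule: rev_cases) auto
    have len: "length cs = length ds"
      using less.prems distinct_card by metis
    show ?thesis
    proof (cases "i = j")
      case True
      have "set cs' = set ds'"
        using less.prems(1-3) unfolding cs ds True by auto
      with True show ?thesis
        using less.hyps[of cs' ds'] less.prems r_ord_snoc[of cs' i n, where 'k = 'k]
          r_ord_snoc[of ds' j n, where 'k = 'k]
        by (simp add: cs ds)
    next
      case False
      define A where "A = set cs - {i, j}"
      obtain as where as: "set as = A" "distinct as"
        using finite_distinct_list[of A] by (auto simp: A_def)
      have ij: "i \<in> {1..n}" "j \<in> {1..n}" "i \<notin> A" "j \<notin> A" "A \<subseteq> {1..n}"
        using less.prems by (auto simp: A_def cs ds)
      have sc: "set cs' = A \<union> {j}"
        using less.prems(1-3) False by (auto simp: A_def cs ds)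
      have sd: "set ds' = A \<union> {i}"
      proof -
        have "i \<in> set ds" "j \<in> set ds" "A = set ds - {i, j}"
          unfolding A_def using less.prems(3) by (auto simp: cs ds)
        then show ?thesis
          using less.prems(2) False by (auto simp: ds)
      qed
      have dist: "distinct cs'" "distinct ds'" "distinct (as @ [j])" "distinct (as @ [i])"
        "i \<notin> set cs'" "j \<notin> set ds'"
        using less.prems as ij by (auto simp: cs ds)
      have sub: "set (as @ [j]) \<subseteq> {1..n}" "set (as @ [i]) \<subseteq> {1..n}"
        "set cs' \<subseteq> {1..n}" "set ds' \<subseteq> {1..n}"
        using as ij sc sd by auto
      have "r_ord n cs = zQ n (A \<union> {j}) i \<oplus>\<^bsub>Q_alg n\<^esub> (r_ord n cs' :: 'k free set)"
        using r_ord_snoc[of cs' i n, where 'k = 'k] less.prems ij by (simp add: cs sc)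
      also have "(r_ord n cs' :: 'k free set) = r_ord n (as @ [j])"
        by (rule less.hyps) (use dist sub as sc in \<open>auto simp: cs\<close>)
      also have "\<dots> = zQ n A j \<oplus>\<^bsub>Q_alg n\<^esub> r_ord n as"
        using r_ord_snoc[OF dist(3) sub(1)] as by simp
      finally have 1: "r_ord n cs = zQ n (A \<union> {j}) i \<oplus>\<^bsub>Q_alg n\<^esub> (zQ n A j \<oplus>\<^bsub>Q_alg n\<^esub> (r_ord n as :: 'k free set))" .
      have "r_ord n ds = zQ n (A \<union> {i}) j \<oplus>\<^bsub>Q_alg n\<^esub> (r_ord n ds' :: 'k free set)"
        using r_ord_snoc[of ds' j n, where 'k = 'k] less.prems ij by (simp add: ds sd)
      also have "(r_ord n ds' :: 'k free set) = r_ord n (as @ [i])"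
        by (rule less.hyps) (use dist sub as sd len in \<open>auto simp: cs ds\<close>)
      also have "\<dots> = zQ n A i \<oplus>\<^bsub>Q_alg n\<^esub> r_ord n as"
        using r_ord_snoc[OF dist(4) sub(2)] as by simp
      finally have 2: "r_ord n ds = zQ n (A \<union> {i}) j \<oplus>\<^bsub>Q_alg n\<^esub> (zQ n A i \<oplus>\<^bsub>Q_alg n\<^esub> (r_ord n as :: 'k free set))" .
      have cl: "zQ n (A \<union> {i}) j \<in> carrier (Q_alg n :: ('k, 'k free set) module)"
        "zQ n (A \<union> {j}) i \<in> carrier (Q_alg n :: ('k, 'k free set) module)"
        "zQ n A i \<in> carrier (Q_alg n :: ('k, 'k free set) module)"
        "zQ n A j \<in> carrier (Q_alg n :: ('k, 'k free set) module)"
        "r_ord n as \<in> carrier (Q_alg n :: ('k, 'k free set) module)"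
        using ij False as by (auto intro!: z_closed r_ord_closed simp del: Q_simps simp: gens_def)
      show ?thesis
        unfolding 1 2 using z_rels(1)[of A n i j, where 'k = 'k] ij False cl
        by (simp only: R.a_assoc[symmetric]) auto
    qed
  qed
qed

lemma r_ord_eq_r_set:
  assumes "distinct cs" "set cs \<subseteq> {1..n}"
  shows "r_ord n cs = (r_set n (set cs) :: ('k::field) free set)"
  unfolding r_set_def by (rule r_ord_indep) (use assms in auto)

text \<open>The skeleton does reach \<open>l + 1\<close>, so the \<open>LEAST\<close> in its definition is attained.\<close>

lemma next_skel_bounds:
  assumes "m \<le> length Bs"
  shows "m < next_skel Bs m" "next_skel Bs m \<le> length Bs + 1"
proof -
  let ?S = "{j. m < j \<and> j \<le> length Bs \<and>
            (\<not> entry Bs j \<subseteq> entry Bs m \<or>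
             int (card (entry Bs j)) \<noteq> int (card (entry Bs m)) + int m - int j)}
         \<union> {length Bs + 1}"
  have fin: "finite ?S"
    by (rule finite_subset[of _ "{..length Bs + 1}"]) auto
  have "Min ?S \<in> ?S" by (rule Min_in[OF fin]) simp
  then show "m < next_skel Bs m" "next_skel Bs m \<le> length Bs + 1"
    unfolding next_skel_def using assms by auto
qed

lemma skel_seq_reaches: "\<exists>q. skel_seq Bs q = length Bs + 1"
proof (rule ccontr)
  assume no: "\<nexists>q. skel_seq Bs q = length Bs + 1"
  have "q < skel_seq Bs q \<and> skel_seq Bs q \<le> length Bs" for q
  proof (induction q)
    case 0
    then show ?case using no[simplified, rule_format, of 0] by (cases Bs) auto
  next
    case (Suc q)
    then show ?case
      using next_skel_bounds[of "skel_seq Bs q" Bs] no[simplified, rule_format, of "Suc q"] by simp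
  qed
  from this[of "length Bs"] show False by linarith
qed

end

theory Submission
  imports Defs
begin

text \<open>
  Put \<open>z\<^bsub>A,i\<^esub> = r(A \<union> {i}) - r(A)\<close>.  The linear relations say that this is consistent, and for
  \<open>i, j \<in> C\<close> and \<open>A = C - {i, j}\<close> the quadratic ones become
    \<open>r(C) r(C-i) - r(C) r(C-j) = r(C-i)\<^sup>2 - r(C-j)\<^sup>2 - r(C-i) r(A) + r(C-j) r(A)\<close>.
  Give the string \<open>(B\<^sub>1, \<dots>, B\<^sub>l)\<close> the weight \<open>|B\<^sub>1| + \<dots> + |B\<^sub>l|\<close>.  The right-hand side has smaller
  weight, so modulo lower weight the second factor of \<open>r(C) r(C-i)\<close> may be replaced by any other
  subset of \<open>C\<close> with one element removed.

  Spanning: two saturated descending chains of equal length that start at \<open>C\<close> therefore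
  agree modulo lower weight (\<open>same_top_chains\<close>).  Hence a maximal run \<open>C, B\<^sub>2, \<dots>, B\<^sub>k\<close> with
  \<open>B\<^sub>j \<subseteq> C\<close> and \<open>|B\<^sub>j| = |C| + 1 - j\<close> may be replaced by the run that removes the maximum at each
  step.  What remains of a string is the list of its blocks \<open>(C, k)\<close>, that is, of the heads of
  its runs with their lengths, and standard strings are the normal forms obtained in this way
  (\<open>standardize\<close>, \<open>is_standard_iff_locally_standard\<close>).

  Independence: a right module is built that has all lists of blocks as a basis.  For a
  vertex \<open>v\<close> let \<open>E\<^sub>v(t)\<close> be the product of the factors \<open>1 + t z\<close> along a chain from \<open>v\<close> down to
  the empty set, the top edge on the left.  By the relations of \<open>Q\<^sub>n\<close> it depends only on \<open>v\<close>; write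
  \<open>E\<^sub>v = \<Sum> e\<^sub>k(v) t\<^sup>k\<close> and \<open>1 / E\<^sub>v = \<Sum> h\<^sub>k(v) t\<^sup>k\<close>, so that \<open>e\<^sub>1(v) = r(v) = - h\<^sub>1(v)\<close>.  The block \<open>(v, k)\<close>
  stands for \<open>e\<^sub>k(v)\<close>, whose leading term is \<open>r(v) r(v') \<dots>\<close> along a chain with \<open>k\<close> members.  For
  \<open>D \<subset> v\<close> with \<open>|v| = |D| + k\<close>, the series \<open>E\<^sub>v / E\<^sub>D\<close>, that is \<open>E\<^sub>v\<close> times \<open>1 / E\<^sub>D\<close> in this order, is a
  product of \<open>k\<close> linear factors, so its coefficient of \<open>t\<close> to the power \<open>k + m\<close> vanishes for \<open>m > 0\<close>:
    \<open>\<Sum>\<^sub>i e\<^sub>i(v) h\<^bsub>k+m-i\<^esub>(D) = 0\<close>.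
  Solved for the term \<open>i = k\<close>, this is a recursion that defines how \<open>h\<^sub>m(D)\<close> multiplies a word whose
  last block is \<open>(v, k)\<close>; after every other last block multiplication is free.  The relations
  of \<open>Q\<^sub>n\<close> all follow from the coefficients of \<open>(1 / E\<^sub>v) (1 + t (r(v) - r(u))) = 1 / E\<^sub>u\<close> for \<open>u\<close> covered
  by \<open>v\<close>; that this identity survives in the module is \<open>act_diff_eq_0\<close>, the heart of the proof.
  Finally \<open>r(B\<^sub>1) \<dots> r(B\<^sub>l)\<close> sends the empty word to the block word of the string plus words of smaller
  weight (\<open>act_r_string_leading\<close>), and a standard string is determined by its block word.
\<close>

section \<open>An action on functions of block words\<close>

type_synonym block = "nat set \<times> nat"

text \<open>
  Block words are lists with the last block at the head.  \<open>continues (v, k) D\<close> says that \<open>D\<close> may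
  occur as the next set of a run that starts with \<open>v\<close> and has \<open>k\<close> members so far.
\<close>

definition continues :: "block \<Rightarrow> nat set \<Rightarrow> bool" where
  "continues b D \<longleftrightarrow> finite (fst b) \<and> D \<subset> fst b \<and> card (fst b) = card D + snd b"

text \<open>
  Instead of right multiplication on linear combinations of words, everything is phrased by the
  dual left action on functions \<open>\<phi>\<close> of words, so that no finite supports are needed.  The
  value of \<open>push v i \<phi>\<close> at \<open>s\<close> is \<open>\<phi>\<close> at the product of \<open>s\<close> and \<open>e\<^sub>i(v)\<close>, formed by appending the block
  \<open>(v, i)\<close>; here \<open>e\<^sub>0(v) = 1\<close>, and \<open>e\<^sub>i(v) = 0\<close> for \<open>i > |v|\<close>.
\<close>

definition push :: "nat set \<Rightarrow> nat \<Rightarrow> (block list \<Rightarrow> 'a) \<Rightarrow> block list \<Rightarrow> 'a::comm_ring_1" where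
  "push v i \<phi> s = (if i = 0 then \<phi> s else if i \<le> card v then \<phi> ((v, i) # s) else 0)"

text \<open>
  Free multiplication by \<open>h\<^sub>m(D)\<close>: it is expressed through the \<open>e\<^sub>i(D)\<close> by
  \<open>h\<^sub>m = - \<Sum>\<^sub>i h\<^bsub>m-i\<^esub> e\<^sub>i\<close> (\<open>1 \<le> i \<le> m\<close>), and blocks are appended without any rewriting.
\<close>

fun append_h :: "nat set \<Rightarrow> nat \<Rightarrow> (block list \<Rightarrow> 'a) \<Rightarrow> block list \<Rightarrow> 'a::comm_ring_1" where
  "append_h D 0 \<phi> s = \<phi> s"
| "append_h D (Suc m) \<phi> s = - (\<Sum>i\<le>m. append_h D (m - i) (push D (Suc i) \<phi>) s)"

text \<open>
  Multiplication by \<open>h\<^sub>m(D)\<close>.  The second equation solves \<open>\<Sum>\<^sub>i e\<^sub>i(v) h\<^bsub>k+m-i\<^esub>(D) = 0\<close> for the summand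
  \<open>i = k\<close>, where \<open>b = (v, k)\<close>.  In the other summands with \<open>i > 0\<close> the block \<open>(v, i)\<close> has the wrong
  length for \<open>D\<close> to continue it, so multiplication is free there; the summand \<open>i = 0\<close> has
  lost the block and is a recursive call.
\<close>

fun act_h :: "nat set \<Rightarrow> nat \<Rightarrow> (block list \<Rightarrow> 'a) \<Rightarrow> block list \<Rightarrow> 'a::comm_ring_1" where
  "act_h D m \<phi> [] = append_h D m \<phi> []"
| "act_h D m \<phi> (b # s) =
    (if 0 < m \<and> continues b D
     then - (\<Sum>i\<in>{1..snd b + m} - {snd b}. push (fst b) i (append_h D (snd b + m - i) \<phi>) s)
          - act_h D (snd b + m) \<phi> s
     else append_h D m \<phi> (b # s))"

definition act_r :: "nat set \<Rightarrow> (block list \<Rightarrow> 'a) \<Rightarrow> block list \<Rightarrow> 'a::comm_ring_1" where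
  "act_r D \<phi> s = - act_h D 1 \<phi> s"

lemma push_0 [simp]: "push v 0 \<phi> = \<phi>"
  by (simp add: push_def fun_eq_iff)

lemma push_lin: "push v i (\<lambda>w. a * \<phi> w + b * \<psi> w) = (\<lambda>s. a * push v i \<phi> s + b * push v i \<psi> s)"
  by (auto simp: push_def)

lemma append_h_lin:
  "append_h D m (\<lambda>w. a * \<phi> w + b * \<psi> w) s = a * append_h D m \<phi> s + b * append_h D m \<psi> s"
proof (induction m arbitrary: \<phi> \<psi> rule: less_induct)
  case (less m)
  show ?case
  proof (cases m)
    case (Suc k)
    then show ?thesis
      by (simp add: push_lin less.IH sum.distrib sum_distrib_left)
  qed simp
qed

lemma act_h_lin:
  "act_h D m (\<lambda>w. a * \<phi> w + b * \<psi> w) s = a * act_h D m \<phi> s + b * act_h D m \<psi> s"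
proof (induction s arbitrary: m)
  case (Cons x s)
  have "append_h D m (\<lambda>w. a * \<phi> w + b * \<psi> w) = (\<lambda>s. a * append_h D m \<phi> s + b * append_h D m \<psi> s)" for m
    by (rule ext) (rule append_h_lin)
  then show ?case
    by (simp add: Cons.IH push_lin append_h_lin sum.distrib sum_distrib_left algebra_simps)
qed (simp add: append_h_lin)

lemma append_h_sum:
  "append_h D m (\<lambda>w. \<Sum>i\<in>I. \<phi> i w) s = (\<Sum>i\<in>I. append_h D m (\<phi> i) s)"
proof (induction I rule: infinite_finite_induct)
  case (insert x I)
  then show ?case using append_h_lin[of D m 1 "\<phi> x" 1 "\<lambda>w. \<Sum>i\<in>I. \<phi> i w" s] by simp
next
  case (infinite A)
  then show ?case using append_h_lin[of D m 0 "\<lambda>_. 0" 0 "\<lambda>_. 0" s] by simp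
next
  case empty
  then show ?case using append_h_lin[of D m 0 "\<lambda>_. 0" 0 "\<lambda>_. 0" s] by simp
qed

lemma act_h_0 [simp]: "act_h D 0 \<phi> = \<phi>"
proof
  show "act_h D 0 \<phi> s = \<phi> s" for s by (cases s) auto
qed

text \<open>
  The coefficients of \<open>(1 / E\<^sub>D) E\<^sub>D = 1\<close> in positive degree.
\<close>

lemma append_h_push_sum:
  assumes "0 < m"
  shows "(\<Sum>p\<le>m. append_h D p (push D (m - p) \<phi>) s) = 0"
proof -
  obtain k where m: "m = Suc k" using assms by (cases m) auto
  have "(\<Sum>p\<le>k. append_h D p (push D (Suc k - p) \<phi>) s) = (\<Sum>i\<le>k. append_h D (k - i) (push D (Suc i) \<phi>) s)"
    by (rule sum.reindex_bij_witness[of _ "\<lambda>i. k - i" "\<lambda>i. k - i"]) (auto simp: Suc_diff_le)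
  then show ?thesis by (simp add: m)
qed

text \<open>
  Free multiplication by \<open>h\<^sub>m(D)\<close>, \<open>m > 0\<close>, produces only words that end in a block with set \<open>D\<close>.
\<close>

lemma append_h_cong_block:
  assumes "0 < m" "\<And>i w. \<lbrakk>0 < i; i \<le> card D\<rbrakk> \<Longrightarrow> \<phi> ((D, i) # w) = \<psi> ((D, i) # w)"
  shows "append_h D m \<phi> s = append_h D m \<psi> s"
proof -
  have "push D (Suc i) \<phi> = push D (Suc i) \<psi>" for i
    using assms(2) by (auto simp: push_def fun_eq_iff)
  with assms(1) show ?thesis by (cases m) auto
qed

definition fresh :: "nat set \<Rightarrow> block list \<Rightarrow> bool" where
  "fresh D s \<longleftrightarrow> (case s of [] \<Rightarrow> True | b # _ \<Rightarrow> \<not> continues b D)"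

lemma act_h_fresh: "fresh D s \<Longrightarrow> act_h D m \<phi> s = append_h D m \<phi> s"
  by (cases s) (auto simp: fresh_def)

text \<open>
  The vanishing coefficients of \<open>E\<^sub>v / E\<^sub>D\<close> hold after every word \<open>s\<close>, since the definition of
  \<open>act_h\<close> at \<open>(v, k) # s\<close> imposes exactly this relation.
\<close>

lemma act_h_push_sum:
  assumes v: "finite v" "D \<subset> v" and N: "card v - card D < N"
  shows "(\<Sum>i\<le>N. push v i (act_h D (N - i) \<phi>) s) = 0"
proof -
  define k where "k = card v - card D"
  have lt: "card D < card v" using v psubset_card_mono by blast
  have k: "0 < k" "k \<le> card v" "k < N" "continues (v, k) D"
    using lt N v by (auto simp: k_def continues_def)
  have other: "push v i (act_h D (N - i) \<phi>) s = push v i (append_h D (N - i) \<phi>) s"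
    if "i \<in> {1..N} - {k}" for i
    using that lt by (auto simp: push_def continues_def k_def)
  have "(\<Sum>i\<le>N. push v i (act_h D (N - i) \<phi>) s)
      = act_h D N \<phi> s + (push v k (act_h D (N - k) \<phi>) s
        + (\<Sum>i\<in>{1..N} - {k}. push v i (act_h D (N - i) \<phi>) s))"
  proof -
    have "{..N} = insert 0 {1..N}" by auto
    moreover have "(\<Sum>i\<in>{1..N}. push v i (act_h D (N - i) \<phi>) s)
        = push v k (act_h D (N - k) \<phi>) s + (\<Sum>i\<in>{1..N} - {k}. push v i (act_h D (N - i) \<phi>) s)"
      by (rule sum.remove) (use k in auto)
    ultimately show ?thesis by simp
  qed
  also have "(\<Sum>i\<in>{1..N} - {k}. push v i (act_h D (N - i) \<phi>) s)
      = (\<Sum>i\<in>{1..N} - {k}. push v i (append_h D (N - i) \<phi>) s)"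
    by (rule sum.cong) (use other in auto)
  also have "push v k (act_h D (N - k) \<phi>) s = - (\<Sum>i\<in>{1..N} - {k}. push v i (append_h D (N - i) \<phi>) s)
          - act_h D N \<phi> s"
    using k by (simp add: push_def)
  finally show ?thesis by simp
qed

text \<open>
  The coefficient of degree \<open>n\<close> in \<open>1 / E\<^sub>u - (1 / E\<^sub>v) (1 + t (r(v) - r(u)))\<close>, which has to act as zero
  when \<open>v\<close> covers \<open>u\<close>.
\<close>

definition act_diff :: "nat set \<Rightarrow> nat set \<Rightarrow> nat \<Rightarrow> (block list \<Rightarrow> 'a) \<Rightarrow> block list \<Rightarrow> 'a::comm_ring_1" where
  "act_diff v u n \<phi> s =
     (if n = 0 then 0 else act_h v (n - 1) (act_r u \<phi>) s - act_h v (n - 1) (act_r v \<phi>) s)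
     + act_h u n \<phi> s - act_h v n \<phi> s"

text \<open>
  If \<open>v\<close> does not continue the last block of \<open>s\<close>, then multiplication by \<open>h\<^sub>p(v)\<close> after \<open>s\<close> is free.
  Write \<open>n = j + 1\<close>.  Since \<open>E\<^sub>v / E\<^sub>u\<close> has degree one, \<open>\<Sum>\<^sub>i e\<^sub>i(v) h\<^bsub>n-p-i\<^esub>(u) = 0\<close> for all \<open>p < j\<close>.
  Multiplying by \<open>h\<^sub>p(v)\<close> on the left, summing over \<open>p < j\<close> and collecting the terms by \<open>q = p + i\<close>, the
  relations \<open>\<Sum>\<^sub>p h\<^sub>p(v) e\<^bsub>q-p\<^esub>(v) = 0\<close> cancel everything except \<open>q = 0\<close>, \<open>q = j\<close> and \<open>q = j + 1\<close>, and
  these three terms are the claim.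
\<close>

lemma act_diff_fresh:
  assumes v: "finite v" "u \<subset> v" "card v = Suc (card u)" and s: "fresh v s"
  shows "act_diff v u n \<phi> s = 0"
proof -
  consider "n = 0" | "n = 1" | j where "n = Suc j" "0 < j"
    by (metis One_nat_def gr0I not0_implies_Suc)
  then show ?thesis
  proof cases
    case 3
    let ?f = "\<lambda>q p. append_h v p (push v (q - p) (act_h u (Suc j - q) \<phi>)) s"
    have "0 = (\<Sum>p<j. append_h v p (\<lambda>w. \<Sum>i\<le>Suc j - p. push v i (act_h u (Suc j - p - i) \<phi>) w) s)"
    proof (rule sum.neutral[symmetric], intro ballI)
      fix p assume "p \<in> {..<j}"
      then have "(\<lambda>w. \<Sum>i\<le>Suc j - p. push v i (act_h u (Suc j - p - i) \<phi>) w) = (\<lambda>w. 0)"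
        by (intro ext act_h_push_sum) (use v in auto)
      then show "append_h v p (\<lambda>w. \<Sum>i\<le>Suc j - p. push v i (act_h u (Suc j - p - i) \<phi>) w) s = 0"
        using append_h_lin[of v p 0 "\<lambda>_. 0" 0 "\<lambda>_. 0" s] by simp
    qed
    also have "\<dots> = (\<Sum>p<j. \<Sum>i\<le>Suc j - p. append_h v p (push v i (act_h u (Suc j - p - i) \<phi>)) s)"
      by (simp add: append_h_sum)
    also have "\<dots> = (\<Sum>p<j. \<Sum>q\<in>{p..Suc j}. ?f q p)"
    proof (rule sum.cong[OF refl])
      fix p assume "p \<in> {..<j}"
      then show "(\<Sum>i\<le>Suc j - p. append_h v p (push v i (act_h u (Suc j - p - i) \<phi>)) s) = (\<Sum>q\<in>{p..Suc j}. ?f q p)"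
        by (intro sum.reindex_bij_witness[of _ "\<lambda>q. q - p" "\<lambda>i. i + p"]) (auto simp: add.commute)
    qed
    also have "\<dots> = (\<Sum>q\<le>Suc j. \<Sum>p\<in>{p. p < j \<and> p \<le> q}. ?f q p)"
    proof -
      have "{p..Suc j} = {q \<in> {..Suc j}. p \<le> q}" for p by auto
      then show ?thesis
        using sum.swap_restrict[of "{..<j}" "{..Suc j}" "\<lambda>p q. ?f q p" "\<lambda>p q. p \<le> q"] by simp
    qed
    also have "\<dots> = act_h u (Suc j) \<phi> s + (\<Sum>p<j. ?f j p) + (\<Sum>p<j. ?f (Suc j) p)"
    proof -
      have z: "(\<Sum>p\<in>{p. p < j \<and> p \<le> q}. ?f q p) = 0" if "q \<in> {1..<j}" for q
      proof -
        have "{p. p < j \<and> p \<le> q} = {..q}" using that by auto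
        then show ?thesis using append_h_push_sum[of q v "act_h u (Suc j - q) \<phi>" s] that by simp
      qed
      have "{..Suc j} = insert 0 (insert j (insert (Suc j) {1..<j}))" using 3 by auto
      moreover have "{p. p < j \<and> p \<le> 0} = {0}" "{p. p < j \<and> p \<le> j} = {..<j}" "{p. p < j \<and> p \<le> Suc j} = {..<j}"
        using 3 by auto
      ultimately show ?thesis using 3 z by simp
    qed
    also have "(\<Sum>p<j. ?f j p) = - append_h v j (act_h u 1 \<phi>) s"
    proof -
      have "(\<Sum>p<j. ?f j p) + ?f j j = 0"
        using append_h_push_sum[of j v "act_h u 1 \<phi>" s] 3 by (simp add: lessThan_Suc_atMost[symmetric])
      then show ?thesis by (simp add: eq_neg_iff_add_eq_0)
    qed
    also have "(\<Sum>p<j. ?f (Suc j) p) = - append_h v (Suc j) \<phi> s - append_h v j (push v 1 \<phi>) s"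
    proof -
      have "(\<Sum>p<j. ?f (Suc j) p) + ?f (Suc j) j + ?f (Suc j) (Suc j) = 0"
        using append_h_push_sum[of "Suc j" v "act_h u 0 \<phi>" s]
        by (simp only: lessThan_Suc_atMost[symmetric] sum.lessThan_Suc) simp
      then have "(\<Sum>p<j. ?f (Suc j) p) = - (?f (Suc j) j + ?f (Suc j) (Suc j))"
        by (simp only: eq_neg_iff_add_eq_0 add.assoc)
      then show ?thesis by (simp del: append_h.simps)
    qed
    finally have main: "act_h u (Suc j) \<phi> s
        = append_h v j (act_h u 1 \<phi>) s + append_h v (Suc j) \<phi> s + append_h v j (push v 1 \<phi>) s"
      by (simp add: algebra_simps del: append_h.simps)
    have "append_h v j (act_r v \<phi>) s = append_h v j (push v 1 \<phi>) s"
    proof (rule append_h_cong_block)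
      fix i w assume i: "0 < i" "i \<le> card v"
      then have "\<not> continues (v, i) v" by (simp add: continues_def)
      then show "act_r v \<phi> ((v, i) # w) = push v 1 \<phi> ((v, i) # w)"
        by (simp add: act_r_def)
    qed (use 3 in simp)
    moreover have "append_h v j (act_r u \<phi>) s = - append_h v j (act_h u 1 \<phi>) s"
      using append_h_lin[of v j "-1" "act_h u 1 \<phi>" 0 "\<lambda>_. 0" s] by (simp add: act_r_def[abs_def])
    ultimately show ?thesis
      using main 3 by (simp add: act_diff_def act_h_fresh[OF s] del: append_h.simps)
  qed (auto simp: act_diff_def act_r_def)
qed

text \<open>
  Suppose that the last block is \<open>(x, k)\<close> and \<open>v\<close> continues it.  Then \<open>u\<close> continues \<open>(x, k + 1)\<close>,
  so \<open>E\<^sub>x / E\<^sub>v\<close> and \<open>E\<^sub>x / E\<^sub>u\<close> have degrees \<open>k\<close> and \<open>k + 1\<close>.  Consequently the sum over all \<open>i\<close> of the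
  defects after \<open>s e\<^sub>i(x)\<close>, taken in degree \<open>k + n - i\<close>, vanishes part by part as soon as \<open>n \<ge> 2\<close>.
  For \<open>i \<noteq> k\<close> the defect vanishes, by the free case or, if \<open>i = 0\<close>, by induction on the word;
  hence it vanishes for \<open>i = k\<close> as well, which is the assertion.
\<close>

lemma act_diff_eq_0:
  fixes \<phi> :: "block list \<Rightarrow> 'a::comm_ring_1"
  assumes v: "finite v" "u \<subset> v" "card v = Suc (card u)"
  shows "act_diff v u n \<phi> s = 0"
proof (induction s arbitrary: n)
  case Nil
  show ?case by (rule act_diff_fresh[OF v]) (simp add: fresh_def)
next
  case (Cons b s)
  obtain x k where b: "b = (x, k)" by fastforce
  consider "n \<le> 1" | "\<not> continues b v" | "2 \<le> n" "continues b v" by linarith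
  then show ?case
  proof cases
    case 1
    then have "n = 0 \<or> n = 1" by linarith
    then show ?thesis by (auto simp: act_diff_def act_r_def)
  next
    case 2
    then show ?thesis by (intro act_diff_fresh[OF v]) (simp add: fresh_def)
  next
    case 3
    then have x: "finite x" "v \<subset> x" "card x = card v + k" by (auto simp: continues_def b)
    have "card v < card x" using x(1,2) by (rule psubset_card_mono)
    then have k: "0 < k" "k \<le> card x" using x(3) by linarith+
    define N where "N = k + n"
    have "k < N - 1" using 3(1) unfolding N_def by linarith
    have star: "(\<Sum>i\<le>M. push x i (act_h w (M - i) \<psi>) s) = 0"
      if "w = v \<and> k < M \<or> w = u \<and> Suc k < M" for w M \<psi>
      by (rule act_h_push_sum) (use that x v in auto)
    \<comment> \<open>The first part of \<open>act_diff\<close> has index \<open>N - i - 1\<close>, so its summand \<open>i = N\<close> is missing.\<close>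
    let ?g = "\<lambda>\<psi> i. push x i (\<lambda>w. if N - i = 0 then 0 else act_h v (N - i - 1) \<psi> w) s"
    have g: "(\<Sum>i\<le>N. ?g \<psi> i) = 0" for \<psi> :: "block list \<Rightarrow> 'a"
    proof -
      have N: "sum f {..N} = sum f {..N - 1} + f N" for f :: "nat \<Rightarrow> 'a"
        using k by (cases N) (auto simp: N_def)
      have "(\<Sum>i\<le>N. ?g \<psi> i) = (\<Sum>i\<le>N - 1. ?g \<psi> i) + ?g \<psi> N"
        by (rule N)
      also have "(\<Sum>i\<le>N - 1. ?g \<psi> i) = (\<Sum>i\<le>N - 1. push x i (act_h v (N - 1 - i) \<psi>) s)"
        using k by (intro sum.cong) (auto simp: push_def N_def)
      also have "\<dots> = 0" by (rule star) (use \<open>k < N - 1\<close> in simp)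
      finally show ?thesis by (simp add: push_def)
    qed
    have "push x i (act_diff v u (N - i) \<phi>) s
        = ?g (act_r u \<phi>) i - ?g (act_r v \<phi>) i + push x i (act_h u (N - i) \<phi>) s
          - push x i (act_h v (N - i) \<phi>) s" for i
      by (auto simp: push_def act_diff_def)
    then have "(\<Sum>i\<le>N. push x i (act_diff v u (N - i) \<phi>) s) = 0"
      using star[of u N \<phi>] star[of v N \<phi>] g[of "act_r u \<phi>"] g[of "act_r v \<phi>"] 3
      by (simp add: sum.distrib sum_subtractf N_def)
    moreover have "push x i (act_diff v u (N - i) \<phi>) s = 0" if "i \<noteq> k" for i
    proof (cases "i = 0")
      case True
      then show ?thesis by (simp add: Cons.IH)
    next
      case False
      have "fresh v ((x, i) # s)" using x that by (auto simp: fresh_def continues_def)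
      then show ?thesis using False by (simp add: push_def act_diff_fresh[OF v])
    qed
    then have "(\<Sum>i\<le>N. push x i (act_diff v u (N - i) \<phi>) s) = push x k (act_diff v u (N - k) \<phi>) s"
      by (subst sum.remove[of _ k]) (auto simp: N_def intro: sum.neutral)
    ultimately show ?thesis using k by (simp add: push_def b N_def)
  qed
qed

text \<open>
  Degree two of \<open>act_diff_eq_0\<close>.  The dependence on \<open>u\<close> sits in \<open>h\<^sub>2(u)\<close> alone.
\<close>

lemma act_r_mult:
  assumes v: "finite v" "u \<subset> v" "card v = Suc (card u)"
  shows "act_r v (act_r u \<phi>) s = act_h u 2 \<phi> s - act_h v 2 \<phi> s + act_r v (act_r v \<phi>) s"
  using act_diff_eq_0[OF v, of 2 \<phi> s] by (simp add: act_diff_def act_r_def algebra_simps numeral_2_eq_2)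

text \<open>
  There are no blocks of positive length on the empty set, so freely appended \<open>h\<^sub>m({})\<close> vanishes;
  the recursion preserves this.
\<close>

lemma act_r_empty: "act_r {} \<phi> s = 0"
proof -
  have ap: "append_h {} m \<phi> s = 0" if "0 < m" for m s and \<phi> :: "block list \<Rightarrow> 'a"
  proof -
    have "append_h {} m \<phi> s = append_h {} m (\<lambda>_. 0) s"
      by (rule append_h_cong_block[OF that]) auto
    then show ?thesis using append_h_lin[of "{}" m 0 "\<lambda>_. 0" 0 "\<lambda>_. 0" s] by simp
  qed
  have "act_h {} m \<phi> s = 0" if "0 < m" for m
    using that
  proof (induction s arbitrary: m)
    case (Cons b s)
    have "push (fst b) i (append_h {} (snd b + m - i) \<phi>) s = 0" if "i \<in> {1..snd b + m} - {snd b}" "continues b {}" for i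
      using that Cons.prems by (cases "i < snd b + m") (auto simp: push_def ap continues_def)
    then show ?case using Cons by (auto simp: ap)
  qed (simp add: ap)
  then show ?thesis by (simp add: act_r_def)
qed

lemma act_r_lin: "act_r D (\<lambda>w. a * \<phi> w + b * \<psi> w) s = a * act_r D \<phi> s + b * act_r D \<psi> s"
  by (simp add: act_r_def act_h_lin algebra_simps)

section \<open>Weights and leading terms\<close>

text \<open>
  The weight \<open>|v| + (|v| - 1) + \<dots>\<close> (\<open>k\<close> summands) of a chain of length \<open>k\<close> that starts with \<open>v\<close>.
\<close>

definition block_weight :: "block \<Rightarrow> nat" where
  "block_weight b = (\<Sum>t<snd b. card (fst b) - t)"

definition word_weight :: "block list \<Rightarrow> nat" where
  "word_weight s = (\<Sum>b\<leftarrow>s. block_weight b)"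

text \<open>
  The leading term of the product of a block word with \<open>r(D)\<close>: either the last block grows by one,
  or a new block starts.
\<close>

fun snoc_set :: "block list \<Rightarrow> nat set \<Rightarrow> block list" where
  "snoc_set [] D = [(D, 1)]"
| "snoc_set (b # s) D = (if continues b D then (fst b, Suc (snd b)) # s else (D, 1) # b # s)"

lemma word_weight_simps [simp]:
  "word_weight [] = 0" "word_weight (b # s) = block_weight b + word_weight s"
  by (simp_all add: word_weight_def)

lemma block_weight_1 [simp]: "block_weight (D, Suc 0) = card D"
  by (simp add: block_weight_def)

lemma block_weight_le_mult: "block_weight (D, i) \<le> i * card D"
  unfolding block_weight_def using sum_bounded_above[of "{..<i}" "\<lambda>t. card D - t" "card D"] by simp

lemma block_weight_shorter:
  assumes "card v = d + k" "i \<le> k"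
  shows "block_weight (v, i) + (k - i) * Suc d \<le> block_weight (v, k)"
proof -
  have "of_nat (card {i..<k}) * Suc d \<le> (\<Sum>t\<in>{i..<k}. card v - t)"
    by (rule sum_bounded_below) (use assms in auto)
  moreover have "block_weight (v, k) = block_weight (v, i) + (\<Sum>t\<in>{i..<k}. card v - t)"
    using assms(2) by (simp add: block_weight_def sum.atLeastLessThan_concat flip: atLeast0LessThan)
  ultimately show ?thesis by simp
qed

lemma block_weight_longer:
  assumes "card v = d + k" "k \<le> i"
  shows "block_weight (v, i) \<le> block_weight (v, k) + (i - k) * d"
proof -
  have "(\<Sum>t\<in>{k..<i}. card v - t) \<le> of_nat (card {k..<i}) * d"
    by (rule sum_bounded_above) (use assms in auto)
  moreover have "block_weight (v, i) = block_weight (v, k) + (\<Sum>t\<in>{k..<i}. card v - t)"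
    using assms(2) by (simp add: block_weight_def sum.atLeastLessThan_concat flip: atLeast0LessThan)
  ultimately show ?thesis by simp
qed

text \<open>
  With \<open>d = |D|\<close>: the increments of \<open>i \<mapsto> block_weight (v, i)\<close> decrease and pass the value \<open>d\<close> at \<open>i = k\<close>, so
  trading members of the chain for copies of \<open>D\<close> does not raise the weight.  By
  \<open>block_weight_shorter\<close> it strictly drops when the chain gets shorter.
\<close>

lemma block_weight_step:
  assumes "card v = d + k"
  shows "block_weight (v, i) + k * d \<le> block_weight (v, k) + i * d"
proof (cases "i \<le> k")
  case True
  then have "block_weight (v, i) + (k - i) * d \<le> block_weight (v, k)"
    using block_weight_shorter[OF assms True] by simp
  moreover have "k * d = (k - i) * d + i * d" using True by (simp flip: add_mult_distrib)
  ultimately show ?thesis by linarith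
next
  case False
  then have "block_weight (v, i) \<le> block_weight (v, k) + (i - k) * d"
    using block_weight_longer[OF assms, of i] by simp
  moreover have "i * d = (i - k) * d + k * d" using False by (simp flip: add_mult_distrib)
  ultimately show ?thesis by linarith
qed

lemma word_weight_snoc_set: "word_weight (snoc_set s D) = word_weight s + card D"
  by (cases s) (auto simp: block_weight_def continues_def)

lemma append_h_eq_0:
  assumes "\<And>w. word_weight w \<le> word_weight s + m * card D \<Longrightarrow> \<phi> w = 0"
  shows "append_h D m \<phi> s = 0"
  using assms
proof (induction m arbitrary: \<phi> rule: less_induct)
  case (less m)
  show ?case
  proof (cases m)
    case (Suc k)
    have "append_h D (k - i) (push D (Suc i) \<phi>) s = 0" if "i \<le> k" for i
    proof (rule less.IH)
      fix w assume w: "word_weight w \<le> word_weight s + (k - i) * card D"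
      have "m * card D = (k - i) * card D + Suc i * card D"
        using that Suc by (simp flip: add_mult_distrib)
      with w block_weight_le_mult[of D "Suc i"] have "word_weight ((D, Suc i) # w) \<le> word_weight s + m * card D"
        by simp
      then show "push D (Suc i) \<phi> w = 0" using less.prems by (simp add: push_def)
    qed (use Suc in simp)
    then show ?thesis using Suc by simp
  qed (use less.prems in simp)
qed

text \<open>
  Multiplication by \<open>h\<^sub>m(D)\<close> raises the weight by at most \<open>m |D|\<close>, stated for dual functions.
\<close>

lemma act_h_eq_0:
  assumes "\<And>w. word_weight w \<le> word_weight s + m * card D \<Longrightarrow> \<phi> w = 0"
  shows "act_h D m \<phi> s = 0"
  using assms
proof (induction s arbitrary: m)
  case Nil
  then show ?case using append_h_eq_0[of "[]" m D \<phi>] by simp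
next
  case (Cons b s)
  show ?case
  proof (cases "0 < m \<and> continues b D")
    case True
    obtain v k where b: "b = (v, k)" by fastforce
    have c: "card v = card D + k" using True by (simp add: b continues_def)
    have "push v i (append_h D (k + m - i) \<phi>) s = 0" if i: "i \<in> {1..k + m}" for i
    proof -
      have "append_h D (k + m - i) \<phi> ((v, i) # s) = 0"
      proof (rule append_h_eq_0)
        fix w assume w: "word_weight w \<le> word_weight ((v, i) # s) + (k + m - i) * card D"
        have "(k + m - i) * card D + i * card D = k * card D + m * card D"
          using i by (simp flip: add_mult_distrib)
        with w block_weight_step[OF c, of i] show "\<phi> w = 0"
          by (intro Cons.prems) (simp add: b)
      qed
      then show ?thesis using i by (simp add: push_def)
    qed
    moreover have "act_h D (k + m) \<phi> s = 0"
    proof (rule Cons.IH)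
      fix w assume w: "word_weight w \<le> word_weight s + (k + m) * card D"
      show "\<phi> w = 0"
        by (rule Cons.prems) (use w block_weight_step[OF c, of 0] in \<open>simp add: b block_weight_def add_mult_distrib\<close>)
    qed
    ultimately show ?thesis using True b by simp
  next
    case False
    moreover have "append_h D m \<phi> (b # s) = 0"
      by (rule append_h_eq_0) (rule Cons.prems)
    ultimately show ?thesis by auto
  qed
qed

text \<open>
  In the recursion for \<open>h\<^sub>1(D)\<close> after \<open>(v, k)\<close> only the summand \<open>i = k + 1\<close>, the extended block, keeps
  the full weight: the summands with \<open>i < k\<close> and the recursive call replace members of the chain
  that are larger than \<open>D\<close> by copies of \<open>D\<close>.
\<close>

lemma act_r_leading:
  assumes D: "finite D" "D \<noteq> {}"
    and \<phi>: "\<And>w. word_weight w < word_weight s + card D \<Longrightarrow> \<phi> w = 0"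
  shows "act_r D \<phi> s = \<phi> (snoc_set s D)"
proof -
  have pos: "0 < card D" using D by (simp add: card_gt_0_iff)
  have one: "append_h D 1 \<phi> s = - \<phi> ((D, 1) # s)" for s
    using pos by (simp add: push_def)
  show ?thesis
  proof (cases s)
    case Nil
    then show ?thesis using one[of "[]"] by (simp add: act_r_def)
  next
    case (Cons b s')
    obtain v k where b: "b = (v, k)" by fastforce
    show ?thesis
    proof (cases "continues b D")
      case True
      then have c: "card v = card D + k" and v: "finite v" "D \<subset> v" by (simp_all add: b continues_def)
      have k: "0 < k" using c psubset_card_mono[OF v] by simp
      have "push v i (append_h D (k + 1 - i) \<phi>) s' = 0" if i: "i \<in> {1..<k}" for i
      proof -
        have "append_h D (k + 1 - i) \<phi> ((v, i) # s') = 0"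
        proof (rule append_h_eq_0)
          fix w assume w: "word_weight w \<le> word_weight ((v, i) # s') + (k + 1 - i) * card D"
          have "(k + 1 - i) * card D = (k - i) * card D + card D"
            using i by (simp add: Suc_diff_le)
          moreover have "block_weight (v, i) + (k - i) * card D < block_weight (v, k)"
          proof -
            have "(k - i) * Suc (card D) = (k - i) * card D + (k - i)" "0 < k - i"
              using i by (simp_all only: mult_Suc_right add.commute) auto
            then show ?thesis using block_weight_shorter[OF c, of i] i by linarith
          qed
          ultimately show "\<phi> w = 0"
            using w by (intro \<phi>) (simp add: Cons b)
        qed
        then show ?thesis using i by (simp add: push_def)
      qed
      then have "(\<Sum>i\<in>{1..<k}. push v i (append_h D (k + 1 - i) \<phi>) s') = 0"
        by simp
      moreover have "{1..k + 1} - {k} = insert (k + 1) {1..<k}" using k by auto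
      ultimately have "(\<Sum>i\<in>{1..k + 1} - {k}. push v i (append_h D (k + 1 - i) \<phi>) s')
          = push v (k + 1) (append_h D 0 \<phi>) s'"
        by simp
      also have "\<dots> = \<phi> (snoc_set s D)"
        using True pos c by (simp add: push_def Cons b)
      also have "act_h D (k + 1) \<phi> s' = 0"
      proof (rule act_h_eq_0)
        fix w assume w: "word_weight w \<le> word_weight s' + (k + 1) * card D"
        have "k * card D < block_weight (v, k)"
          using block_weight_shorter[OF c, of 0] k by simp
        with w show "\<phi> w = 0" by (intro \<phi>) (simp add: Cons b)
      qed
      ultimately show ?thesis using True by (simp add: act_r_def Cons b del: snoc_set.simps)
    next
      case False
      then show ?thesis using one[of "b # s'"] by (simp add: act_r_def Cons)
    qed
  qed
qed

lemma act_r_eq_0: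
  assumes "\<And>w. word_weight w \<le> word_weight s + card D \<Longrightarrow> \<phi> w = 0"
  shows "act_r D \<phi> s = 0"
  unfolding act_r_def using act_h_eq_0[of s 1 D \<phi>] assms by simp

lemma act_r_string_leading:
  assumes "\<forall>B\<in>set Bs. finite B \<and> B \<noteq> {}"
    and "\<And>w. word_weight w < word_weight s + (\<Sum>B\<leftarrow>Bs. card B) \<Longrightarrow> \<phi> w = 0"
  shows "foldr act_r Bs \<phi> s = \<phi> (foldl snoc_set s Bs)"
proof -
  have van: "foldr act_r Bs \<phi> s = 0"
    if "\<And>w. word_weight w \<le> word_weight s + (\<Sum>B\<leftarrow>Bs. card B) \<Longrightarrow> \<phi> w = 0" for s
    using that
  proof (induction Bs arbitrary: s)
    case (Cons B Bs)
    have "act_r B (foldr act_r Bs \<phi>) s = 0"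
      by (rule act_r_eq_0, rule Cons.IH) (use Cons.prems in simp)
    then show ?case by simp
  qed simp
  have van_less: "foldr act_r Bs \<phi> s' = 0"
    if "word_weight s' + (\<Sum>B\<leftarrow>Bs. card B) < m" "\<And>w. word_weight w < m \<Longrightarrow> \<phi> w = 0"
    for s' m and Bs :: "nat set list"
    using that
  proof (induction Bs arbitrary: s')
    case (Cons B Bs)
    have "act_r B (foldr act_r Bs \<phi>) s' = 0"
      by (rule act_r_eq_0, rule Cons.IH) (use Cons.prems in auto)
    then show ?case by simp
  qed simp
  show ?thesis
    using assms
  proof (induction Bs arbitrary: s)
    case (Cons B Bs)
    have "act_r B (foldr act_r Bs \<phi>) s = foldr act_r Bs \<phi> (snoc_set s B)"
    proof (rule act_r_leading)
      fix w assume "word_weight w < word_weight s + card B"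
      then show "foldr act_r Bs \<phi> w = 0"
        using Cons.prems(2)
        by (intro van_less[where m = "word_weight s + (card B + (\<Sum>B\<leftarrow>Bs. card B))"]) simp_all
    qed (use Cons.prems(1) in auto)
    also have "\<dots> = \<phi> (foldl snoc_set (snoc_set s B) Bs)"
      by (rule Cons.IH) (use Cons.prems in \<open>auto simp: word_weight_snoc_set\<close>)
    finally show ?case by simp
  qed simp
qed

section \<open>Standard strings as block words\<close>

definition strip_max :: "nat set \<Rightarrow> nat set" where
  "strip_max C = C - {Max C}"

definition block_sets :: "block \<Rightarrow> nat set list" where
  "block_sets b = map (\<lambda>t. (strip_max ^^ t) (fst b)) [0..<snd b]"

text \<open>
  The standard string with a given block word.
\<close>

definition concat_blocks :: "block list \<Rightarrow> nat set list" where
  "concat_blocks s = concat (map block_sets (rev s))"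

abbreviation blocks :: "nat set list \<Rightarrow> block list" where
  "blocks Bs \<equiv> foldl snoc_set [] Bs"

lemma concat_blocks_simps [simp]: "concat_blocks [] = []" "concat_blocks (b # s) = concat_blocks s @ block_sets b"
  by (simp_all add: concat_blocks_def)

lemma block_sets_Suc: "block_sets (v, Suc k) = block_sets (v, k) @ [(strip_max ^^ k) v]"
  by (simp add: block_sets_def)

lemma strip_max_funpow:
  assumes "finite v" "k \<le> card v"
  shows "(strip_max ^^ k) v \<subseteq> v" "card ((strip_max ^^ k) v) = card v - k"
proof -
  have "(strip_max ^^ k) v \<subseteq> v \<and> card ((strip_max ^^ k) v) = card v - k"
    using assms(2)
  proof (induction k)
    case (Suc k)
    let ?C = "(strip_max ^^ k) v"
    have IH: "?C \<subseteq> v" "card ?C = card v - k" using Suc by auto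
    have "finite ?C" using IH(1) assms(1) finite_subset by blast
    moreover have "?C \<noteq> {}" using IH(2) Suc.prems by auto
    ultimately have "Max ?C \<in> ?C" by (rule Max_in)
    moreover have "(strip_max ^^ Suc k) v = ?C - {Max ?C}" by (simp add: strip_max_def[of ?C])
    ultimately show ?case using IH \<open>finite ?C\<close> by auto
  qed simp
  then show "(strip_max ^^ k) v \<subseteq> v" "card ((strip_max ^^ k) v) = card v - k" by auto
qed

text \<open>
  Standardness in terms of the block word of each prefix; unlike the skeleton, block words can be
  computed by adding one set at a time, so this form suits induction on the string.
\<close>

definition locally_standard :: "nat set list \<Rightarrow> bool" where
  "locally_standard Bs \<longleftrightarrow> (\<forall>i. 0 < i \<longrightarrow> i < length Bs \<longrightarrow>
     continues (hd (blocks (take i Bs))) (Bs ! i) \<longrightarrow> Bs ! i = strip_max (Bs ! (i - 1)))"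

lemma locally_standard_snoc:
  "locally_standard (Bs @ [D]) \<longleftrightarrow> locally_standard Bs \<and>
     (Bs \<noteq> [] \<longrightarrow> continues (hd (blocks Bs)) D \<longrightarrow> D = strip_max (last Bs))"
proof -
  have "locally_standard (Bs @ [D]) \<longleftrightarrow> (\<forall>i. i < Suc (length Bs) \<longrightarrow> 0 < i \<longrightarrow>
     continues (hd (blocks (take i (Bs @ [D])))) ((Bs @ [D]) ! i) \<longrightarrow>
     (Bs @ [D]) ! i = strip_max ((Bs @ [D]) ! (i - 1)))"
    unfolding locally_standard_def by auto
  also have "\<dots> \<longleftrightarrow> locally_standard Bs \<and>
     (Bs \<noteq> [] \<longrightarrow> continues (hd (blocks Bs)) D \<longrightarrow> D = strip_max (last Bs))"
    unfolding locally_standard_def All_less_Suc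
    by (auto simp: nth_append last_conv_nth)
  finally show ?thesis .
qed

lemma blocks_nonempty: "Bs \<noteq> [] \<Longrightarrow> \<exists>v k s. blocks Bs = (v, Suc k) # s"
proof (induction Bs rule: rev_induct)
  case (snoc D Bs)
  show ?case
  proof (cases "blocks Bs")
    case (Cons b s)
    then show ?thesis by (cases b) auto
  qed simp
qed simp

text \<open>
  A standard string can be recovered from its block word.
\<close>

lemma concat_blocks_of_standard:
  assumes "locally_standard Bs"
  shows "concat_blocks (blocks Bs) = Bs"
  using assms
proof (induction Bs rule: rev_induct)
  case (snoc D Bs)
  then have IH: "concat_blocks (blocks Bs) = Bs" by (simp add: locally_standard_snoc)
  show ?case
  proof (cases "Bs = []")
    case False
    then obtain v k s where b: "blocks Bs = (v, Suc k) # s" using blocks_nonempty by blast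
    show ?thesis
    proof (cases "continues (v, Suc k) D")
      case True
      then have "D = strip_max (last Bs)"
        using snoc.prems False b by (simp add: locally_standard_snoc)
      also have "last Bs = (strip_max ^^ k) v"
        by (subst IH[symmetric]) (simp add: b block_sets_Suc)
      finally show ?thesis
        using True IH by (simp add: b block_sets_Suc[of v "Suc k"])
    next
      case new: False
      then show ?thesis using IH by (simp add: b block_sets_def[of "(D, 1)"] block_sets_def[of "(D, Suc 0)"])
    qed
  qed (simp add: block_sets_def)
qed simp

text \<open>
  In the case of a continued block \<open>(v, k + 1)\<close> the set \<open>D\<close> gets replaced by a subset of \<open>v\<close> of the same
  cardinality.  Whether a set continues a block depends on its cardinality once it is a subset of
  \<open>v\<close>, so the block word does not notice.
\<close>

lemma standardize:
  assumes "is_string n Bs"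
  shows "is_string n (concat_blocks (blocks Bs))" "blocks (concat_blocks (blocks Bs)) = blocks Bs"
    "locally_standard (concat_blocks (blocks Bs))"
proof -
  have "is_string n (concat_blocks (blocks Bs)) \<and> blocks (concat_blocks (blocks Bs)) = blocks Bs
      \<and> locally_standard (concat_blocks (blocks Bs))"
    using assms
  proof (induction Bs rule: rev_induct)
    case Nil
    then show ?case by (simp add: locally_standard_def)
  next
    case (snoc D Bs)
    have Bs: "is_string n Bs" and D: "D \<noteq> {}" "D \<subseteq> {1..n}"
      using snoc.prems by (auto simp: is_string_def)
    have IH: "is_string n (concat_blocks (blocks Bs))" "blocks (concat_blocks (blocks Bs)) = blocks Bs"
      "locally_standard (concat_blocks (blocks Bs))"
      using snoc.IH[OF Bs] by blast+
    have "finite D" using D finite_subset by blast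
    show ?case
    proof (cases "Bs = []")
      case True
      then show ?thesis using D by (simp add: block_sets_def is_string_def locally_standard_def)
    next
      case False
      then obtain v k s where b: "blocks Bs = (v, Suc k) # s" using blocks_nonempty by blast
      show ?thesis
      proof (cases "continues (v, Suc k) D")
        case True
        let ?E = "(strip_max ^^ Suc k) v"
        have c: "finite v" "card v = card D + Suc k" using True by (auto simp: continues_def)
        have E: "?E \<subseteq> v" "card ?E = card D"
          using strip_max_funpow[of v "Suc k"] c by auto
        have "card ?E \<noteq> 0" using E(2) D(1) \<open>finite D\<close> by simp
        then have "?E \<noteq> {}" by (metis card.empty)
        moreover have "v \<in> set (concat_blocks (blocks Bs))"
          by (auto simp: b block_sets_def intro!: image_eqI[of _ _ 0])
        then have "v \<subseteq> {1..n}" using IH(1) unfolding is_string_def by blast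
        ultimately have str: "is_string n (concat_blocks (blocks Bs) @ [?E])"
          using IH(1) E(1) unfolding is_string_def by auto
        have cE: "continues (v, Suc k) ?E"
          using E c by (auto simp: continues_def)
        have eq: "concat_blocks (blocks (Bs @ [D])) = concat_blocks (blocks Bs) @ [?E]"
          using True by (simp add: b block_sets_Suc[of v "Suc k"])
        have "last (concat_blocks (blocks Bs)) = (strip_max ^^ k) v"
          by (simp add: b block_sets_Suc)
        then have "locally_standard (concat_blocks (blocks Bs) @ [?E])"
          using IH(3) by (simp add: locally_standard_snoc)
        moreover have "blocks (concat_blocks (blocks Bs) @ [?E]) = blocks (Bs @ [D])"
          using True cE IH(2) by (simp add: b)
        ultimately show ?thesis using str eq by metis
      next
        case new: False
        then have eq: "concat_blocks (blocks (Bs @ [D])) = concat_blocks (blocks Bs) @ [D]"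
          by (simp add: b block_sets_def[of "(D, Suc 0)"])
        have "is_string n (concat_blocks (blocks Bs) @ [D])"
          using IH(1) D unfolding is_string_def by auto
        moreover have "locally_standard (concat_blocks (blocks Bs) @ [D])"
          using IH new unfolding locally_standard_snoc by (simp add: b)
        moreover have "blocks (concat_blocks (blocks Bs) @ [D]) = blocks (Bs @ [D])"
          using IH(2) by simp
        ultimately show ?thesis using eq by metis
      qed
    qed
  qed
  then show "is_string n (concat_blocks (blocks Bs))" "blocks (concat_blocks (blocks Bs)) = blocks Bs"
    "locally_standard (concat_blocks (blocks Bs))" by auto
qed

text \<open>
  With \<open>j\<close> running upwards from the skeleton point \<open>m\<close>, the skeleton condition at \<open>j\<close> compares \<open>B\<^sub>j\<close> with
  a block that has head \<open>B\<^sub>m\<close> and the \<open>j - m\<close> members \<open>B\<^sub>m, \<dots>, B\<^bsub>j-1\<^esub>\<close>.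
\<close>

lemma next_skel_iff:
  assumes m: "1 \<le> m" "m \<le> length Bs" and fin: "\<forall>B\<in>set Bs. finite B"
  shows "\<lbrakk>m < j; j < next_skel Bs m\<rbrakk> \<Longrightarrow> continues (entry Bs m, j - m) (entry Bs j)"
    "next_skel Bs m \<le> length Bs \<Longrightarrow>
       \<not> continues (entry Bs m, next_skel Bs m - m) (entry Bs (next_skel Bs m))"
proof -
  let ?P = "\<lambda>j. \<not> entry Bs j \<subseteq> entry Bs m \<or>
             int (card (entry Bs j)) \<noteq> int (card (entry Bs m)) + int m - int j"
  let ?S = "{j. m < j \<and> j \<le> length Bs \<and> ?P j} \<union> {length Bs + 1}"
  have finS: "finite ?S"
    by (rule finite_subset[of _ "{..length Bs + 1}"]) auto
  have nx: "next_skel Bs m = Min ?S" by (simp add: next_skel_def)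
  have P: "?P j \<longleftrightarrow> \<not> continues (entry Bs m, j - m) (entry Bs j)" if "m < j" "j \<le> length Bs" for j
  proof -
    have "finite (entry Bs m)" using fin m by simp
    then show ?thesis using that(1) by (auto simp: continues_def)
  qed
  show "continues (entry Bs m, j - m) (entry Bs j)" if j: "m < j" "j < next_skel Bs m"
  proof -
    have l: "j \<le> length Bs" using j(2) next_skel_bounds(2)[OF m(2)] by linarith
    have "j \<notin> ?S" using j(2) Min_le[OF finS, of j] unfolding nx by linarith
    then show ?thesis using P[OF j(1) l] j(1) l by blast
  qed
  show "\<not> continues (entry Bs m, next_skel Bs m - m) (entry Bs (next_skel Bs m))"
    if l: "next_skel Bs m \<le> length Bs"
  proof -
    have "Min ?S \<in> ?S" by (rule Min_in[OF finS]) simp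
    then have "?P (next_skel Bs m)" using l unfolding nx by simp
    then show ?thesis using P[OF next_skel_bounds(1)[OF m(2)] l] by blast
  qed
qed

lemma hd_blocks_take_Suc:
  assumes "0 < i" "i < length Bs"
  shows "hd (blocks (take (Suc i) Bs)) =
    (if continues (hd (blocks (take i Bs))) (Bs ! i)
     then (fst (hd (blocks (take i Bs))), Suc (snd (hd (blocks (take i Bs))))) else (Bs ! i, 1))"
proof -
  have "take i Bs \<noteq> []" using assms by auto
  then obtain v k s where "blocks (take i Bs) = (v, Suc k) # s" using blocks_nonempty by blast
  then show ?thesis using assms by (simp add: take_Suc_conv_app_nth)
qed

lemma hd_blocks_within:
  assumes m: "1 \<le> m" "m \<le> length Bs" and fin: "\<forall>B\<in>set Bs. finite B"
    and start: "hd (blocks (take m Bs)) = (entry Bs m, 1)"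
    and i: "m \<le> i" "i < next_skel Bs m"
  shows "hd (blocks (take i Bs)) = (entry Bs m, Suc i - m)"
  using i
proof (induction i rule: dec_induct)
  case base
  then show ?case using start by simp
next
  case (step i)
  have "i < length Bs" using step.prems next_skel_bounds(2)[OF m(2)] by linarith
  moreover have "continues (entry Bs m, Suc i - m) (Bs ! i)"
    using next_skel_iff(1)[OF m fin, of "Suc i"] step by simp
  ultimately show ?case
    using step m hd_blocks_take_Suc[of i Bs] by (simp add: Suc_diff_le)
qed

lemma hd_blocks_next_skel:
  assumes m: "1 \<le> m" "m \<le> length Bs" and fin: "\<forall>B\<in>set Bs. finite B"
    and start: "hd (blocks (take m Bs)) = (entry Bs m, 1)"
    and le: "next_skel Bs m \<le> length Bs"
  shows "\<not> continues (hd (blocks (take (next_skel Bs m - 1) Bs))) (entry Bs (next_skel Bs m))"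
    "hd (blocks (take (next_skel Bs m) Bs)) = (entry Bs (next_skel Bs m), 1)"
proof -
  have gt: "m < next_skel Bs m" by (rule next_skel_bounds(1)[OF m(2)])
  have "hd (blocks (take (next_skel Bs m - 1) Bs)) = (entry Bs m, Suc (next_skel Bs m - 1) - m)"
    by (rule hd_blocks_within[OF m fin start]) (use gt in auto)
  then show *: "\<not> continues (hd (blocks (take (next_skel Bs m - 1) Bs))) (entry Bs (next_skel Bs m))"
    using next_skel_iff(2)[OF m fin le] gt by simp
  show "hd (blocks (take (next_skel Bs m) Bs)) = (entry Bs (next_skel Bs m), 1)"
    using hd_blocks_take_Suc[of "next_skel Bs m - 1" Bs] * gt le m by simp
qed

text \<open>
  A new block starts at every skeleton point, and by \<open>hd_blocks_within\<close> nowhere else.  The bound on \<open>q\<close> excludes the final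
  skeleton entry \<open>l + 1\<close>, which is no position of the string.
\<close>

lemma skel_seq_start:
  assumes fin: "\<forall>B\<in>set Bs. finite B" and q: "q < (LEAST q. skel_seq Bs q = length Bs + 1)"
  shows "1 \<le> skel_seq Bs q \<and> skel_seq Bs q \<le> length Bs \<and>
    hd (blocks (take (skel_seq Bs q) Bs)) = (entry Bs (skel_seq Bs q), 1)"
  using q
proof (induction q)
  case 0
  then have "Bs \<noteq> []" using not_less_Least[OF 0] by auto
  then show ?case by (cases Bs) auto
next
  case (Suc q)
  let ?m = "skel_seq Bs q"
  have IH: "1 \<le> ?m" "?m \<le> length Bs" "hd (blocks (take ?m Bs)) = (entry Bs ?m, 1)"
    using Suc by auto
  have "next_skel Bs ?m \<le> length Bs"
    using not_less_Least[OF Suc.prems] next_skel_bounds(2)[OF IH(2)] by simp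
  then show ?case
    using hd_blocks_next_skel(2)[OF IH(1,2) fin IH(3)] next_skel_bounds(1)[OF IH(2)] by simp
qed

text \<open>
  Both conditions constrain \<open>B\<^bsub>i+1\<^esub>\<close> precisely when \<open>i + 1\<close> lies inside a block.  There the sizes
  force \<open>B\<^bsub>i+1\<^esub> \<noteq> B\<^sub>i\<close>; since no \<open>B\<^sub>i\<close> contains 0, the value \<open>e_str = 0\<close> is impossible, and \<open>e_str\<close> is the
  maximum of \<open>B\<^sub>i\<close>.
\<close>

lemma is_standard_iff_locally_standard:
  assumes "is_string n Bs"
  shows "is_standard Bs \<longleftrightarrow> locally_standard Bs"
proof -
  have str: "B \<noteq> {}" "B \<subseteq> {1..n}" "finite B" if "B \<in> set Bs" for B
    using assms that finite_subset[of B "{1..n}"] by (auto simp: is_string_def)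
  then have fin: "\<forall>B\<in>set Bs. finite B" by blast
  define t where "t = (LEAST q. skel_seq Bs q = length Bs + 1)"
  have t: "skel_seq Bs t = length Bs + 1"
    unfolding t_def by (rule LeastI_ex[OF skel_seq_reaches])
  note start = skel_seq_start[OF fin, folded t_def]
  have len: "length (skeleton Bs) = Suc t"
    by (simp add: skeleton_def t_def)
  have nth: "skeleton Bs ! q = skel_seq Bs q" if "q \<le> t" for q
    using that unfolding skeleton_def t_def[symmetric] by (simp del: upt_Suc)
  have std: "is_standard Bs \<longleftrightarrow> (\<forall>q i. q < t \<longrightarrow> skel_seq Bs q \<le> i \<longrightarrow> Suc i < skel_seq Bs (Suc q) \<longrightarrow>
       Bs ! i = entry Bs i - {e_str (entry Bs i) (drop i Bs)})"
    unfolding is_standard_def len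
    by (intro iff_allI imp_cong) (auto simp: nth simp del: skel_seq.simps)
  have within: "hd (blocks (take i Bs)) = (entry Bs (skel_seq Bs q), Suc i - skel_seq Bs q)"
    if "q < t" "skel_seq Bs q \<le> i" "i < skel_seq Bs (Suc q)" for q i
    using hd_blocks_within[of "skel_seq Bs q" Bs i] start[OF that(1)] fin that by simp
  show ?thesis
  proof
    assume S: "is_standard Bs"
    show "locally_standard Bs"
      unfolding locally_standard_def
    proof (intro allI impI)
      fix i assume i: "0 < i" "i < length Bs" and c: "continues (hd (blocks (take i Bs))) (Bs ! i)"
      \<comment> \<open>The block containing position \<open>i\<close> ends before the first skeleton point beyond \<open>i\<close>.\<close>
      define p where "p = (LEAST p. i < skel_seq Bs p)"
      have ip: "i < skel_seq Bs p" unfolding p_def by (rule LeastI[of _ t]) (use i t in simp)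
      have pt: "p \<le> t" unfolding p_def by (rule Least_le) (use i t in simp)
      have "p \<noteq> 0" using ip i by (intro notI) simp
      then obtain q where pq: "p = Suc q" using not0_implies_Suc by blast
      have q: "q < t" "skel_seq Bs q \<le> i" "i < skel_seq Bs (Suc q)"
        using pq pt ip not_less_Least[of q "\<lambda>p. i < skel_seq Bs p"] by (auto simp: p_def)
      let ?m = "skel_seq Bs q"
      have m: "1 \<le> ?m" "?m \<le> length Bs" "hd (blocks (take ?m Bs)) = (entry Bs ?m, 1)"
        using start[OF q(1)] by auto
      have "Suc i \<noteq> next_skel Bs ?m"
      proof
        assume "Suc i = next_skel Bs ?m"
        from hd_blocks_next_skel(1)[OF m(1,2) fin m(3), folded this] show False using c i by simp
      qed
      then have i': "Suc i < skel_seq Bs (Suc q)" using q(3) by simp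
      then have eq: "Bs ! i = entry Bs i - {e_str (entry Bs i) (drop i Bs)}"
        using S q std by blast
      have mem: "Bs ! i \<in> set Bs" "entry Bs i \<in> set Bs" using i by auto
      have "card (entry Bs ?m) = card (Bs ! i) + (Suc i - ?m)"
        using c within[OF q] by (simp add: continues_def)
      moreover have "card (entry Bs ?m) = card (entry Bs i) + (i - ?m)"
      proof (cases "i = ?m")
        case False
        then have "continues (entry Bs ?m, i - ?m) (entry Bs i)"
          using next_skel_iff(1)[OF m(1,2) fin, of i] q by simp
        then show ?thesis by (simp add: continues_def)
      qed simp
      ultimately have "Bs ! i \<noteq> entry Bs i" using q(2) by auto
      then have "e_str (entry Bs i) (drop i Bs) \<in> entry Bs i" using eq by blast
      moreover have "0 \<notin> entry Bs i" using str(2)[OF mem(2)] by auto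
      ultimately have "e_str (entry Bs i) (drop i Bs) = Max (entry Bs i)"
        by (auto simp: e_str_def split: if_splits)
      then show "Bs ! i = strip_max (entry Bs i)" using eq by (simp add: strip_max_def)
    qed
  next
    assume L: "locally_standard Bs"
    show "is_standard Bs"
      unfolding std
    proof (intro allI impI)
      fix q i assume q: "q < t" "skel_seq Bs q \<le> i" "Suc i < skel_seq Bs (Suc q)"
      let ?m = "skel_seq Bs q"
      have m: "1 \<le> ?m" "?m \<le> length Bs" using start[OF q(1)] by auto
      have i: "0 < i" "i < length Bs"
        using q m next_skel_bounds(2)[OF m(2)] by auto
      have "continues (hd (blocks (take i Bs))) (Bs ! i)"
        using within[of q i] q next_skel_iff(1)[OF m fin, of "Suc i"] by simp
      then have eq: "Bs ! i = strip_max (entry Bs i)"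
        using L i by (simp add: locally_standard_def)
      have "entry Bs i \<in> set Bs" using i by simp
      then have "Max (entry Bs i) \<in> entry Bs i" using str by (intro Max_in) auto
      moreover have "hd (drop i Bs) = Bs ! i" "drop i Bs \<noteq> []" using i by (simp_all add: hd_drop_conv_nth)
      ultimately have "e_str (entry Bs i) (drop i Bs) = Max (entry Bs i)"
        using eq by (auto simp: e_str_def strip_max_def)
      then show "Bs ! i = entry Bs i - {e_str (entry Bs i) (drop i Bs)}"
        using eq by (simp add: strip_max_def)
    qed
  qed
qed

lemma std_strings_eq: "std_strings n = {Bs. is_string n Bs \<and> locally_standard Bs}"
  using is_standard_iff_locally_standard by (auto simp: std_strings_def)

section \<open>The free algebra acts through its quotient\<close>

definition act_gen :: "gen \<Rightarrow> (block list \<Rightarrow> 'k) \<Rightarrow> block list \<Rightarrow> 'k::field" where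
  "act_gen g \<phi> s = act_r (insert (snd g) (fst g)) \<phi> s - act_r (fst g) \<phi> s"

definition act_free :: "'k free \<Rightarrow> (block list \<Rightarrow> 'k) \<Rightarrow> block list \<Rightarrow> 'k::field" where
  "act_free p \<phi> s = (\<Sum>w\<in>Poly_Mapping.keys p. Poly_Mapping.lookup p w * foldr act_gen (letters w) \<phi> s)"

lemma act_gen_lin: "act_gen g (\<lambda>w. a * \<phi> w + b * \<psi> w) s = a * act_gen g \<phi> s + b * act_gen g \<psi> s"
  by (simp add: act_gen_def act_r_lin algebra_simps)

lemma act_word_lin:
  "foldr act_gen gs (\<lambda>w. a * \<phi> w + b * \<psi> w) s = a * foldr act_gen gs \<phi> s + b * foldr act_gen gs \<psi> s"
proof (induction gs arbitrary: s)
  case (Cons g gs)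
  have "foldr act_gen gs (\<lambda>w. a * \<phi> w + b * \<psi> w) = (\<lambda>s. a * foldr act_gen gs \<phi> s + b * foldr act_gen gs \<psi> s)"
    by (rule ext) (rule Cons.IH)
  then show ?case by (simp add: act_gen_lin)
qed simp

lemma act_word_zero: "foldr act_gen gs (\<lambda>_. 0) s = 0"
  using act_word_lin[of gs 0 "\<lambda>_. 0" 0 "\<lambda>_. 0" s] by simp

lemma free_induct [case_names zero add]:
  assumes "P 0" "\<And>p w a. P p \<Longrightarrow> P (p + Poly_Mapping.single w a)"
  shows "P (p :: 'k::field free)"
proof (induction p rule: Poly_Mapping.update_induct)
  case const
  show ?case by (rule assms(1))
next
  case (update p w a)
  have "Poly_Mapping.update w a p = p + Poly_Mapping.single w a"
    using update.hyps
    by (intro poly_mapping_eqI)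
      (auto simp: lookup_update lookup_add lookup_single when_def in_keys_iff)
  then show ?case using assms(2)[OF update.IH] by simp
qed

lemma act_free_superset:
  assumes "finite K" "Poly_Mapping.keys p \<subseteq> K"
  shows "act_free p \<phi> s = (\<Sum>w\<in>K. Poly_Mapping.lookup p w * foldr act_gen (letters w) \<phi> s)"
  unfolding act_free_def using assms
  by (intro sum.mono_neutral_left) (auto simp: in_keys_iff)

lemma act_free_add: "act_free (p + q) \<phi> s = act_free p \<phi> s + act_free q \<phi> s"
proof -
  let ?K = "Poly_Mapping.keys p \<union> Poly_Mapping.keys q"
  have "Poly_Mapping.keys (p + q) \<subseteq> ?K" by (rule keys_add)
  then show ?thesis
    using act_free_superset[of ?K "p + q"] act_free_superset[of ?K p] act_free_superset[of ?K q]
    by (simp add: lookup_add sum.distrib algebra_simps)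
qed

lemma act_free_0 [simp]: "act_free 0 \<phi> s = 0"
  by (simp add: act_free_def)

lemma act_free_single: "act_free (Poly_Mapping.single w a) \<phi> s = a * foldr act_gen (letters w) \<phi> s"
  using act_free_superset[of "{w}" "Poly_Mapping.single w a"] by simp

lemma act_free_uminus: "act_free (- p) \<phi> s = - act_free p \<phi> s"
  using act_free_add[of p "- p" \<phi> s] by (simp add: eq_neg_iff_add_eq_0 add.commute)

lemma act_free_diff: "act_free (p - q) \<phi> s = act_free p \<phi> s - act_free q \<phi> s"
  using act_free_add[of p "- q" \<phi> s] by (simp add: act_free_uminus)

lemma act_free_mult: "act_free (p * q) \<phi> = act_free p (act_free q \<phi>)"
proof -
  have single: "act_free (Poly_Mapping.single w a * q) \<phi> s = a * foldr act_gen (letters w) (act_free q \<phi>) s"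
    for w a s
  proof (induction q rule: free_induct)
    case zero
    show ?case by (simp add: act_free_def act_word_zero)
  next
    case (add q v b)
    have "act_free (q + Poly_Mapping.single v b) \<phi>
        = (\<lambda>s. 1 * act_free q \<phi> s + b * foldr act_gen (letters v) \<phi> s)"
      by (simp add: fun_eq_iff act_free_add act_free_single)
    then show ?case
      using add by (simp only: act_word_lin distrib_left act_free_add mult_single)
        (simp add: act_free_single algebra_simps)
  qed
  show ?thesis
  proof
    show "act_free (p * q) \<phi> s = act_free p (act_free q \<phi>) s" for s
      by (induction p rule: free_induct)
        (simp_all add: distrib_right act_free_add single act_free_single)
  qed
qed

lemma act_free_1: "act_free 1 \<phi> = \<phi>"
  using act_free_single[of 0 1 \<phi>] by (simp add: fun_eq_iff)

lemma act_free_const: "act_free (const_free c) \<phi> s = c * \<phi> s"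
  by (simp add: const_free_def act_free_single)

lemma act_free_zfree: "act_free (zfree A i) \<phi> s = act_r (insert i A) \<phi> s - act_r A \<phi> s"
  by (simp add: zfree_def act_free_single act_gen_def)

lemma act_free_fun_0: "act_free p (\<lambda>_. 0) s = 0"
  by (simp add: act_free_def act_word_zero)

lemma act_r_diff: "act_r D (\<lambda>w. \<phi> w - \<psi> w) s = act_r D \<phi> s - act_r D \<psi> s"
  using act_r_lin[of D 1 \<phi> "-1" \<psi> s] by simp

lemma act_free_linear_rel:
  assumes "i \<notin> A" "j \<notin> A"
  shows "act_free (zfree (A \<union> {i}) j + zfree A i - (zfree (A \<union> {j}) i + zfree A j)) \<phi> s = 0"
proof -
  have "insert j (A \<union> {i}) = insert i (A \<union> {j})" by auto
  then show ?thesis by (simp add: act_free_add act_free_diff act_free_zfree)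
qed

text \<open>
  By \<open>act_r_mult\<close> for the covers \<open>A \<union> {i} \<subset> C\<close> and \<open>A \<subset> A \<union> {i}\<close>, the product
  \<open>(r(C) - r(A \<union> {i})) (r(A \<union> {i}) - r(A))\<close> acts as \<open>r(C)\<^sup>2 - h\<^sub>2(C) + h\<^sub>2(A) - r(C) r(A)\<close>: the terms with
  \<open>A \<union> {i}\<close> cancel, so \<open>i\<close> and \<open>j\<close> may be exchanged.
\<close>

lemma act_free_quadratic_rel:
  fixes \<phi> :: "block list \<Rightarrow> 'k::field"
  assumes A: "finite A" "i \<notin> A" "j \<notin> A" "i \<noteq> j"
  shows "act_free (zfree (A \<union> {i}) j * zfree A i - zfree (A \<union> {j}) i * zfree A j) \<phi> s = 0"
proof -
  let ?C = "insert j (insert i A)"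
  have prod: "act_free (zfree (A \<union> {i}) j * zfree A i) \<phi> s
      = act_r ?C (act_r ?C \<phi>) s - act_h ?C 2 \<phi> s + act_h A 2 \<phi> s - act_r ?C (act_r A \<phi>) s"
    if i: "i \<notin> A" "j \<notin> A" "i \<noteq> j" "?C = insert j (insert i A)" for i j
  proof -
    have z: "act_free (zfree A i) \<phi> = (\<lambda>s. act_r (insert i A) \<phi> s - act_r A \<phi> s)"
      by (simp add: fun_eq_iff act_free_zfree)
    have Ci: "finite ?C" "insert i A \<subset> ?C" "card ?C = Suc (card (insert i A))"
      using A(1) i by auto
    have iA: "finite (insert i A)" "A \<subset> insert i A" "card (insert i A) = Suc (card A)"
      using A(1) i by auto
    show ?thesis
      unfolding act_free_mult z
      using act_r_mult[OF Ci, of \<phi> s] act_r_mult[OF iA, of \<phi> s] i(4)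
      by (simp add: act_free_zfree act_r_diff)
  qed
  have "act_free (zfree (A \<union> {i}) j * zfree A i) \<phi> s = act_free (zfree (A \<union> {j}) i * zfree A j) \<phi> s"
    using prod[of i j] prod[of j i] A by (simp add: insert_commute)
  then show ?thesis by (simp add: act_free_diff)
qed

lemma act_free_Q_ideal:
  fixes \<phi> :: "block list \<Rightarrow> 'k::field"
  assumes "p \<in> Q_ideal n"
  shows "act_free p \<phi> s = 0"
proof -
  let ?F = "free_alg n :: 'k free ring"
  interpret R: ring ?F by (rule free_alg_ring)
  let ?K = "{p \<in> carrier ?F. \<forall>\<phi> s. act_free p \<phi> s = 0}"
  have zero: "act_free p \<phi> = (\<lambda>_. 0)" if "p \<in> ?K" for p \<phi>
    using that by auto
  have "ideal ?K ?F"
  proof (rule idealI[OF free_alg_ring])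
    show "subgroup ?K (add_monoid ?F)"
    proof (rule group.subgroupI)
      show "group (add_monoid ?F)" by (rule R.a_group)
      show "?K \<subseteq> carrier (add_monoid ?F)" by auto
      show "?K \<noteq> {}" using R.zero_closed by (auto intro!: exI[of _ 0])
      show "inv\<^bsub>add_monoid ?F\<^esub> p \<in> ?K" if p: "p \<in> ?K" for p
      proof -
        have "inv\<^bsub>add_monoid ?F\<^esub> p = - p"
          using R.minus_equality[of "- p" p] p free_alg_closed(3)[of p n]
          by (simp add: a_inv_def)
        then show ?thesis using p free_alg_closed(3) by (auto simp: act_free_uminus)
      qed
      show "p \<otimes>\<^bsub>add_monoid ?F\<^esub> q \<in> ?K" if "p \<in> ?K" "q \<in> ?K" for p q
        using that free_alg_closed(1) by (auto simp: act_free_add)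
    qed
    show "x \<otimes>\<^bsub>?F\<^esub> a \<in> ?K" "a \<otimes>\<^bsub>?F\<^esub> x \<in> ?K" if a: "a \<in> ?K" and x: "x \<in> carrier ?F" for a x
      using a x free_alg_closed(2)[of x n a] free_alg_closed(2)[of a n x]
      by (auto simp: act_free_mult zero[OF a] act_free_fun_0)
  qed
  moreover have "Q_rels n \<subseteq> ?K"
  proof
    fix p :: "'k free" assume p: "p \<in> Q_rels n"
    have "act_free p \<phi> s = 0" for \<phi> s
      using p unfolding Q_rels_def
      by (auto intro!: act_free_linear_rel act_free_quadratic_rel finite_subset[of _ "{1..n}"]
          simp del: insert_iff Un_insert_right)
    then show "p \<in> ?K" using p Q_rels_closed by blast
  qed
  ultimately have "Q_ideal n \<subseteq> ?K"
    unfolding Q_ideal_def by (rule R.genideal_minimal)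
  then show ?thesis using assms by blast
qed

section \<open>The elements r(A) and their relation\<close>

abbreviation quo :: "nat \<Rightarrow> ('k::field) free \<Rightarrow> 'k free set" where
  "quo n p \<equiv> Q_ideal n +>\<^bsub>free_alg n\<^esub> p"

lemma Q_ideal_closed:
  fixes p q :: "('k::field) free"
  shows "p \<in> Q_ideal n \<Longrightarrow> p \<in> carrier (free_alg n)"
    "0 \<in> (Q_ideal n :: 'k free set)"
    "\<lbrakk>p \<in> Q_ideal n; q \<in> Q_ideal n\<rbrakk> \<Longrightarrow> p + q \<in> Q_ideal n"
    "\<lbrakk>p \<in> carrier (free_alg n); q \<in> Q_ideal n\<rbrakk> \<Longrightarrow> p * q \<in> Q_ideal n"
    "\<lbrakk>q \<in> Q_ideal n; p \<in> carrier (free_alg n)\<rbrakk> \<Longrightarrow> q * p \<in> Q_ideal n"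
    "p \<in> Q_ideal n \<Longrightarrow> - p \<in> Q_ideal n"
    "\<lbrakk>p \<in> Q_ideal n; q \<in> Q_ideal n\<rbrakk> \<Longrightarrow> p - q \<in> Q_ideal n"
proof -
  interpret I: ideal "Q_ideal n :: 'k free set" "free_alg n" by (rule Q_ideal_ideal)
  show "p \<in> Q_ideal n \<Longrightarrow> p \<in> carrier (free_alg n)"
    by (rule I.a_Hcarr)
  show "0 \<in> (Q_ideal n :: 'k free set)" using additive_subgroup.zero_closed[OF I.is_additive_subgroup] by simp
  show add: "p + q \<in> Q_ideal n" if "p \<in> Q_ideal n" "q \<in> Q_ideal n" for p q :: "'k free"
    using additive_subgroup.a_closed[OF I.is_additive_subgroup that] by simp
  show l: "p * q \<in> Q_ideal n" if "p \<in> carrier (free_alg n)" "q \<in> Q_ideal n" for p q :: "'k free"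
    using I.I_l_closed[OF that(2,1)] by simp
  show "q \<in> Q_ideal n \<Longrightarrow> p \<in> carrier (free_alg n) \<Longrightarrow> q * p \<in> Q_ideal n"
    using I.I_r_closed by simp
  show neg: "- p \<in> Q_ideal n" if "p \<in> Q_ideal n" for p :: "'k free"
    using l[OF const_free_closed[of "-1"] that] by (simp add: const_free_def single_uminus)
  show "\<lbrakk>p \<in> Q_ideal n; q \<in> Q_ideal n\<rbrakk> \<Longrightarrow> p - q \<in> Q_ideal n"
    using add[OF _ neg, of p q] by simp
qed

lemma quo_eqD:
  fixes p q :: "('k::field) free"
  assumes "p \<in> carrier (free_alg n)" "quo n p = quo n q"
  shows "p - q \<in> Q_ideal n"
proof -
  interpret I: ideal "Q_ideal n :: 'k free set" "free_alg n" by (rule Q_ideal_ideal)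
  have "p \<in> quo n p"
    using assms(1) Q_ideal_closed(2)[of n] unfolding a_r_coset_def' by force
  then have "\<exists>h\<in>Q_ideal n. p = h + q"
    unfolding assms(2) by (simp add: a_r_coset_def')
  then obtain h where "h \<in> Q_ideal n" "p = h + q" by blast
  then show ?thesis by simp
qed

lemma quo_hom:
  fixes p q :: "('k::field) free"
  assumes "p \<in> carrier (free_alg n)" "q \<in> carrier (free_alg n)"
  shows "quo n (p + q) = quo n p \<oplus>\<^bsub>Q_alg n\<^esub> quo n q"
    "quo n (p * q) = quo n p \<otimes>\<^bsub>Q_alg n\<^esub> quo n q"
  using ring_hom_add[OF quot_hom assms] ring_hom_mult[OF quot_hom assms] by simp_all

lemma quo_closed: "p \<in> carrier (free_alg n) \<Longrightarrow> quo n p \<in> carrier (Q_alg n)"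
  using ring_hom_closed[OF quot_hom] by simp

lemma quo_0: "quo n (0 :: ('k::field) free) = \<zero>\<^bsub>Q_alg n\<^esub>"
proof -
  interpret I: ideal "Q_ideal n :: 'k free set" "free_alg n" by (rule Q_ideal_ideal)
  have "quo n (0 :: 'k free) = Q_ideal n" by (auto simp: a_r_coset_def')
  then show ?thesis by (simp add: Q_ring_def FactRing_def)
qed

lemma free_alg_0_1: "0 \<in> carrier (free_alg n)" "1 \<in> carrier (free_alg n)"
  by (simp_all add: free_alg_carrier)

lemma free_alg_sum:
  "(\<And>x. x \<in> X \<Longrightarrow> f x \<in> carrier (free_alg n)) \<Longrightarrow> sum f X \<in> carrier (free_alg n)"
  by (induction X rule: infinite_finite_induct) (auto simp: free_alg_0_1 free_alg_closed)

lemma quo_sum: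
  fixes f :: "'a \<Rightarrow> ('k::field) free"
  assumes "finite X" "\<And>x. x \<in> X \<Longrightarrow> f x \<in> carrier (free_alg n)"
  shows "quo n (sum f X) = (\<Oplus>\<^bsub>Q_alg n\<^esub> x \<in> X. quo n (f x))"
proof -
  interpret R: ring "Q_alg n :: ('k, 'k free set) module" by (rule Q_is_ring)
  show ?thesis
    using assms
  proof (induction X rule: finite_induct)
    case (insert x X)
    have "sum f X \<in> carrier (free_alg n)" using insert.prems by (intro free_alg_sum) auto
    then have "quo n (sum f (insert x X)) = quo n (f x) \<oplus>\<^bsub>Q_alg n\<^esub> (\<Oplus>\<^bsub>Q_alg n\<^esub> x \<in> X. quo n (f x))"
      using insert quo_hom(1)[of "f x" n "sum f X"] by simp
    also have "\<dots> = (\<Oplus>\<^bsub>Q_alg n\<^esub> x \<in> insert x X. quo n (f x))"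
      using insert by (intro R.finsum_insert[symmetric]) (auto intro!: quo_closed simp del: Q_simps)
    finally show ?case .
  qed (simp only: quo_0 sum.empty R.finsum_empty)
qed

text \<open>
  The representative of \<open>r(A)\<close> in the free algebra given by the increasing enumeration of \<open>A\<close>.
  Calculations are carried out in the free algebra modulo the ideal.
\<close>

definition free_r :: "nat set \<Rightarrow> ('k::field) free" where
  "free_r A = (let cs = sorted_list_of_set A in \<Sum>v<length cs. zfree (set (take v cs)) (cs ! v))"

definition free_r_str :: "nat set list \<Rightarrow> ('k::field) free" where
  "free_r_str Bs = foldr (*) (map free_r Bs) 1"

lemma free_r_term:
  assumes "A \<subseteq> {1..n}" "v < length (sorted_list_of_set A)"
  shows "(set (take v (sorted_list_of_set A)), sorted_list_of_set A ! v) \<in> gens n"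
proof -
  let ?cs = "sorted_list_of_set A"
  have "finite A" using assms(1) finite_subset by blast
  then have cs: "distinct ?cs" "set ?cs \<subseteq> {1..n}" using assms(1) by auto
  have "?cs ! v \<notin> set (take v ?cs)"
    using cs assms(2) by (auto simp: in_set_conv_nth nth_eq_iff_index_eq)
  then show ?thesis
    using cs(2) set_take_subset[of v ?cs] nth_mem[OF assms(2)] unfolding gens_def by blast
qed

lemma free_r_closed: "A \<subseteq> {1..n} \<Longrightarrow> free_r A \<in> carrier (free_alg n)"
  unfolding free_r_def Let_def by (intro free_alg_sum zfree_closed free_r_term) auto

lemma free_r_empty [simp]: "free_r {} = 0"
  by (simp add: free_r_def)

lemma quo_free_r:
  assumes "A \<subseteq> {1..n}"
  shows "quo n (free_r A) = r_set n A"
  unfolding free_r_def r_set_def r_ord_def Let_def zQ_def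
  by (rule quo_sum) (simp, rule zfree_closed, rule free_r_term[OF assms], simp)

lemma free_r_str_simps [simp]:
  "free_r_str [] = 1" "free_r_str (B # Bs) = free_r B * free_r_str Bs"
  "free_r_str (Bs @ Cs) = free_r_str Bs * free_r_str Cs"
  by (simp_all add: free_r_str_def) (induction Bs; simp add: mult.assoc)

lemma free_r_str_closed:
  "set Bs \<subseteq> Pow {1..n} \<Longrightarrow> free_r_str Bs \<in> carrier (free_alg n)"
  by (induction Bs) (auto simp: free_alg_0_1 intro!: free_alg_closed free_r_closed)

lemma quo_free_r_str:
  "set Bs \<subseteq> Pow {1..n} \<Longrightarrow> quo n (free_r_str Bs) = (r_str n Bs :: ('k::field) free set)"
proof (induction Bs)
  case Nil
  show ?case using ring_hom_one[OF quot_hom[where 'k = 'k and n = n]] by (simp add: r_str_def)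
next
  case (Cons B Bs)
  then show ?case
    using quo_hom(2)[of "free_r B" n "free_r_str Bs :: 'k free"]
    by (simp add: free_r_closed free_r_str_closed quo_free_r r_str_def)
qed

text \<open>
  The sum telescopes along the chain of initial segments of \<open>A\<close>, down to \<open>r({}) = 0\<close>.
\<close>

lemma act_free_r: "finite A \<Longrightarrow> act_free (free_r A) \<phi> s = act_r A \<phi> s"
proof -
  assume fin: "finite A"
  let ?cs = "sorted_list_of_set A"
  have sum: "act_free (\<Sum>v<m. f v) \<phi> s = (\<Sum>v<m. act_free (f v) \<phi> s)" for m :: nat and f
    by (induction m) (simp_all add: act_free_add)
  have "act_free (free_r A) \<phi> s = (\<Sum>v<length ?cs. act_r (insert (?cs ! v) (set (take v ?cs))) \<phi> s - act_r (set (take v ?cs)) \<phi> s)"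
    by (simp add: free_r_def Let_def sum act_free_zfree)
  also have "\<dots> = (\<Sum>v<length ?cs. act_r (set (take (Suc v) ?cs)) \<phi> s - act_r (set (take v ?cs)) \<phi> s)"
    by (rule sum.cong) (simp_all add: take_Suc_conv_app_nth)
  also have "\<dots> = act_r (set (take (length ?cs) ?cs)) \<phi> s - act_r (set (take 0 ?cs)) \<phi> s"
    by (rule sum_lessThan_telescope)
  also have "\<dots> = act_r A \<phi> s" using fin by (simp add: act_r_empty)
  finally show ?thesis .
qed

lemma act_free_r_str: "\<forall>B\<in>set Bs. finite B \<Longrightarrow> act_free (free_r_str Bs) \<phi> = foldr act_r Bs \<phi>"
proof (induction Bs)
  case (Cons B Bs)
  then show ?case by (intro ext) (simp add: act_free_mult act_free_r)
qed (simp add: act_free_1)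

lemma zfree_cong_free_r:
  assumes A: "A \<subseteq> {1..n}" "i \<in> {1..n}" "i \<notin> A"
  shows "(zfree A i - (free_r (insert i A) - free_r A) :: ('k::field) free) \<in> Q_ideal n"
proof -
  let ?cs = "sorted_list_of_set A"
  have fin: "finite A" using A finite_subset by blast
  have c: "zfree A i \<in> carrier (free_alg n :: 'k free ring)" "free_r A \<in> carrier (free_alg n :: 'k free ring)"
    "free_r (insert i A) \<in> carrier (free_alg n :: 'k free ring)"
    using A by (auto intro!: zfree_closed free_r_closed simp: gens_def)
  have "quo n (free_r (insert i A)) = (r_ord n (?cs @ [i]) :: 'k free set)"
    using A fin r_ord_eq_r_set[of "?cs @ [i]" n, where 'k = 'k] by (simp add: quo_free_r)
  also have "\<dots> = quo n (zfree A i + free_r A)"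
    using A fin r_ord_snoc[of ?cs i n, where 'k = 'k] c
    by (simp add: quo_hom(1) quo_free_r r_set_def zQ_def)
  finally have "free_r (insert i A) - (zfree A i + free_r A) \<in> (Q_ideal n :: 'k free set)"
    by (intro quo_eqD c)
  from Q_ideal_closed(6)[OF this] show ?thesis by (simp add: algebra_simps)
qed

text \<open>
  The quadratic defining relation after the substitution \<open>z\<^bsub>A,i\<^esub> = r(A \<union> {i}) - r(A)\<close>.
\<close>

lemma free_r_relation:
  assumes C: "C \<subseteq> {1..n}" "i \<in> C" "j \<in> C" "i \<noteq> j"
  shows "(free_r C * (free_r (C - {i}) - free_r (C - {j}))
      - (free_r (C - {i}) * free_r (C - {i}) - free_r (C - {j}) * free_r (C - {j})
         - free_r (C - {i}) * free_r (C - {i, j}) + free_r (C - {j}) * free_r (C - {i, j})) :: ('k::field) free)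
    \<in> Q_ideal n"
proof -
  define A where "A = C - {i, j}"
  let ?I = "Q_ideal n :: 'k free set"
  have prod: "zfree (insert i A) j * zfree A i - (free_r C - free_r (insert i A)) * (free_r (insert i A) - free_r A) \<in> ?I"
    if "i \<noteq> j" "i \<notin> A" "j \<notin> A" "insert j (insert i A) = C" for i j
  proof -
    have g: "insert i A \<subseteq> {1..n}" "A \<subseteq> {1..n}" "i \<in> {1..n}" "j \<in> {1..n}" "j \<notin> insert i A"
      using that C(1) by auto
    have 1: "zfree (insert i A) j - (free_r C - free_r (insert i A)) \<in> ?I"
      using zfree_cong_free_r[OF g(1,4,5)] that(4) by simp
    have 2: "zfree A i - (free_r (insert i A) - free_r A) \<in> ?I"
      using zfree_cong_free_r[OF g(2,3) that(2)] .
    have c: "zfree A i \<in> carrier (free_alg n :: 'k free ring)"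
      "free_r C - free_r (insert i A) \<in> carrier (free_alg n :: 'k free ring)"
      using g C(1) that by (auto intro!: zfree_closed free_r_closed free_alg_closed simp: gens_def)
    have "(zfree (insert i A) j - (free_r C - free_r (insert i A))) * zfree A i
        + (free_r C - free_r (insert i A)) * (zfree A i - (free_r (insert i A) - free_r A)) \<in> ?I"
      by (intro Q_ideal_closed(3,4,5) 1 2 c)
    then show ?thesis by (simp add: algebra_simps)
  qed
  have CA: "insert j (insert i A) = C" "insert i (insert j A) = C" "C - {i} = insert j A" "C - {j} = insert i A"
    "i \<notin> A" "j \<notin> A" "A \<subseteq> {1..n}" "i \<in> {1..n} - A" "j \<in> {1..n} - A"
    using C by (auto simp: A_def)
  have "zfree (A \<union> {i}) j * zfree A i - zfree (A \<union> {j}) i * zfree A j \<in> (Q_rels n :: 'k free set)"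
    unfolding Q_rels_def
    by (intro UnI2 CollectI exI[of _ A] exI[of _ i] exI[of _ j]) (use CA(7-9) C(4) in simp)
  moreover have "Q_rels n \<subseteq> ?I"
    unfolding Q_ideal_def by (rule ring.genideal_self[OF free_alg_ring Q_rels_closed])
  ultimately have "zfree (insert i A) j * zfree A i - zfree (insert j A) i * zfree A j \<in> ?I" by auto
  from Q_ideal_closed(7)[OF this prod[of i j]] C(4) CA
  have "zfree (insert i A) j * zfree A i - zfree (insert j A) i * zfree A j
    - (zfree (insert i A) j * zfree A i - (free_r C - free_r (insert i A)) * (free_r (insert i A) - free_r A)) \<in> ?I"
    by simp
  from Q_ideal_closed(3)[OF this prod[of j i]] C(4) CA
  have "zfree (insert i A) j * zfree A i - zfree (insert j A) i * zfree A j
    - (zfree (insert i A) j * zfree A i - (free_r C - free_r (insert i A)) * (free_r (insert i A) - free_r A))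
    + (zfree (insert j A) i * zfree A j - (free_r C - free_r (insert j A)) * (free_r (insert j A) - free_r A)) \<in> ?I"
    by simp
  from Q_ideal_closed(6)[OF this] show ?thesis
    unfolding CA(3,4) A_def[symmetric] by (simp add: algebra_simps)
qed

section \<open>Standard strings span\<close>

interpretation free: vector_space "\<lambda>c (p :: 'k::field free). const_free c * p"
  by unfold_locales (simp_all add: const_free_hom algebra_simps)

definition str_weight :: "nat set list \<Rightarrow> nat" where
  "str_weight Bs = (\<Sum>B\<leftarrow>Bs. card B)"

lemma str_weight_simps [simp]:
  "str_weight [] = 0" "str_weight (B # Bs) = card B + str_weight Bs"
  "str_weight (Bs @ Cs) = str_weight Bs + str_weight Cs"
  by (simp_all add: str_weight_def)

text \<open>
  The products \<open>r(B\<^sub>1) \<dots> r(B\<^sub>l)\<close> of weight below \<open>m\<close>, together with the ideal.  Strings with empty entries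
  are admitted, because the relation for \<open>C = {i, j}\<close> involves \<open>r({}) = 0\<close>.
\<close>

definition low :: "nat \<Rightarrow> nat \<Rightarrow> ('k::field) free set" where
  "low n m = free.span (free_r_str ` {Bs. set Bs \<subseteq> Pow {1..n} \<and> str_weight Bs < m} \<union> Q_ideal n)"

lemma low_str: "\<lbrakk>set Bs \<subseteq> Pow {1..n}; str_weight Bs < m\<rbrakk> \<Longrightarrow> free_r_str Bs \<in> low n m"
  unfolding low_def by (rule free.span_base) blast

lemma low_ideal: "p \<in> Q_ideal n \<Longrightarrow> p \<in> low n m"
  unfolding low_def by (rule free.span_base) blast

lemma low_subspace: "p \<in> low n m \<Longrightarrow> q \<in> low n m \<Longrightarrow> p + q \<in> low n m"
    "p \<in> low n m \<Longrightarrow> - p \<in> low n m"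
  unfolding low_def by (rule free.span_add free.span_neg; assumption)+

lemma low_context:
  fixes p :: "('k::field) free"
  assumes p: "p \<in> low n m" and \<alpha>: "set \<alpha> \<subseteq> Pow {1..n}" and \<beta>: "set \<beta> \<subseteq> Pow {1..n}"
  shows "free_r_str \<alpha> * p * free_r_str \<beta> \<in> low n (str_weight \<alpha> + m + str_weight \<beta>)"
  using p unfolding low_def[of n m]
proof (induction p rule: free.span_induct)
  case base
  show ?case
    unfolding free.subspace_def low_def
  proof (intro conjI ballI allI, goal_cases)
    case 1
    then show ?case by (simp add: free.span_zero)
  next
    case (2 x y)
    then show ?case by (simp add: distrib_left distrib_right free.span_add)
  next
    case (3 c x)
    have "free_r_str \<alpha> * (const_free c * x) * free_r_str \<beta> = const_free c * (free_r_str \<alpha> * x * free_r_str \<beta>)"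
      by (simp add: const_free_central[of c "free_r_str \<alpha>"] flip: mult.assoc)
    then show ?case using 3 by (simp add: free.span_scale)
  qed
next
  case (step x)
  then show ?case
  proof
    assume "x \<in> free_r_str ` {Bs. set Bs \<subseteq> Pow {1..n} \<and> str_weight Bs < m}"
    then obtain Bs where Bs: "x = free_r_str Bs" "set Bs \<subseteq> Pow {1..n}" "str_weight Bs < m" by blast
    have "free_r_str (\<alpha> @ Bs @ \<beta>) \<in> low n (str_weight \<alpha> + m + str_weight \<beta>)"
      by (rule low_str) (use Bs \<alpha> \<beta> in auto)
    then show ?thesis by (simp add: Bs mult.assoc)
  next
    assume "x \<in> Q_ideal n"
    then have "free_r_str \<alpha> * x * free_r_str \<beta> \<in> Q_ideal n"
      by (intro Q_ideal_closed(4,5) free_r_str_closed \<alpha> \<beta>)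
    then show ?thesis by (rule low_ideal)
  qed
qed

text \<open>
  Equality in the graded algebra associated with the weight filtration.  The first argument only
  fixes the field.
\<close>

definition same_top :: "'k::field itself \<Rightarrow> nat \<Rightarrow> nat set list \<Rightarrow> nat set list \<Rightarrow> bool" where
  "same_top _ n Bs Cs \<longleftrightarrow> str_weight Bs = str_weight Cs \<and>
     (free_r_str Bs - free_r_str Cs :: 'k free) \<in> low n (str_weight Bs)"

lemma same_top_refl [simp]: "same_top K n Bs Bs"
  by (simp add: same_top_def low_ideal Q_ideal_closed)

lemma same_top_trans [trans]:
  fixes K :: "'k::field itself"
  assumes "same_top K n Bs Cs" "same_top K n Cs Ds"
  shows "same_top K n Bs Ds"
proof -
  have w: "str_weight Bs = str_weight Cs" "str_weight Cs = str_weight Ds"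
    and d: "(free_r_str Bs - free_r_str Cs :: 'k free) \<in> low n (str_weight Bs)"
      "(free_r_str Cs - free_r_str Ds :: 'k free) \<in> low n (str_weight Cs)"
    using assms unfolding same_top_def by blast+
  show ?thesis
    using low_subspace(1)[OF d[unfolded w]] w by (simp add: same_top_def)
qed

lemma same_top_context:
  assumes "same_top (K :: 'a::field itself) n Bs Cs" "set \<alpha> \<subseteq> Pow {1..n}" "set \<beta> \<subseteq> Pow {1..n}"
  shows "same_top K n (\<alpha> @ Bs @ \<beta>) (\<alpha> @ Cs @ \<beta>)"
proof -
  have "str_weight Bs = str_weight Cs" and "(free_r_str Bs - free_r_str Cs :: 'a free) \<in> low n (str_weight Bs)"
    using assms(1) unfolding same_top_def by blast+
  from low_context[OF this(2) assms(2,3)] this(1) show ?thesis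
    by (simp add: same_top_def algebra_simps)
qed

lemma same_top_pair:
  assumes C: "C \<subseteq> {1..n}" "i \<in> C" "j \<in> C"
  shows "same_top (K :: 'k::field itself) n [C, C - {i}] [C, C - {j}]"
proof (cases "i = j")
  case False
  let ?m = "card C + (card C - 1)"
  have fin: "finite C" using C(1) finite_subset by blast
  then have pos: "0 < card C" using C(2) card_gt_0_iff by blast
  have card: "card (C - {i}) = card C - 1" "card (C - {j}) = card C - 1" "card (C - {i, j}) \<le> card C - 1"
    using fin C card_mono[of "C - {i}" "C - {i, j}"] by auto
  let ?i = "C - {i}" and ?j = "C - {j}" and ?ij = "C - {i, j}"
  have low: "(free_r_str [X, Y] :: 'k free) \<in> low n ?m"
    if "X \<in> {?i, ?j}" "Y \<in> {?i, ?j, ?ij}" for X Y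
    by (rule low_str) (use that C card pos in auto)
  have "(free_r C * (free_r ?i - free_r ?j)
      - (free_r ?i * free_r ?i - free_r ?j * free_r ?j
         - free_r ?i * free_r ?ij + free_r ?j * free_r ?ij) :: 'k free)
      + (free_r_str [?i, ?i] + - free_r_str [?j, ?j] + - free_r_str [?i, ?ij] + free_r_str [?j, ?ij])
      \<in> low n ?m"
    by (intro low_subspace low_ideal free_r_relation low C False) auto
  then show ?thesis
    using card by (simp add: same_top_def algebra_simps)
qed simp

definition covers :: "nat set \<Rightarrow> nat set \<Rightarrow> bool" where
  "covers C D \<longleftrightarrow> (\<exists>i\<in>C. D = C - {i})"

lemma successively_covers_subset:
  "successively covers (C # Xs) \<Longrightarrow> set Xs \<subseteq> Pow C"
proof (induction Xs arbitrary: C)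
  case (Cons X Xs)
  then have "set Xs \<subseteq> Pow X" "X \<subseteq> C" by (auto simp: covers_def)
  then show ?case by auto
qed simp

lemma successively_covers_length:
  "\<lbrakk>finite C; successively covers (C # Xs)\<rbrakk> \<Longrightarrow> length Xs \<le> card C"
proof (induction Xs arbitrary: C)
  case (Cons X Xs)
  then obtain i where "i \<in> C" "X = C - {i}" by (auto simp: covers_def)
  moreover have "0 < card C" using \<open>i \<in> C\<close> Cons.prems(1) card_gt_0_iff by blast
  ultimately show ?case using Cons.IH[of X] Cons.prems by auto
qed simp

lemma block_sets_Suc_left: "block_sets (v, Suc k) = v # block_sets (strip_max v, k)"
  by (simp add: block_sets_def map_upt_Suc funpow_Suc_right del: upt_Suc funpow.simps(2))

lemma covers_strip_max: "finite v \<Longrightarrow> v \<noteq> {} \<Longrightarrow> covers v (strip_max v)"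
  unfolding covers_def strip_max_def by (rule bexI[of _ "Max v"]) simp_all

lemma successively_block_sets:
  "finite v \<Longrightarrow> k \<le> card v \<Longrightarrow> successively covers (block_sets (v, Suc k))"
proof (induction k arbitrary: v)
  case (Suc k)
  have v: "v \<noteq> {}" using Suc.prems(2) by auto
  then have "card (strip_max v) = card v - 1" "finite (strip_max v)"
    using Suc.prems by (auto simp: strip_max_def)
  then have "successively covers (block_sets (strip_max v, Suc k))"
    by (intro Suc.IH) (use Suc.prems(2) in simp_all)
  moreover obtain Ws where "block_sets (strip_max v, Suc k) = strip_max v # Ws"
    using block_sets_Suc_left by blast
  ultimately show ?case
    using covers_strip_max[OF Suc.prems(1) v] by (simp add: block_sets_Suc_left[of v "Suc k"])
qed (simp add: block_sets_def)

lemma exists_chain: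
  assumes "finite C" "D \<subseteq> C" "card C = card D + k"
  shows "\<exists>Xs. length Xs = k \<and> successively covers (C # Xs) \<and> last (C # Xs) = D"
  using assms
proof (induction k arbitrary: C)
  case 0
  then have "D = C" using card_subset_eq[of C D] by simp
  then show ?case by (intro exI[of _ "[]"]) simp
next
  case (Suc k)
  have "C \<noteq> D" using Suc.prems(3) by auto
  then obtain i where i: "i \<in> C" "i \<notin> D" using Suc.prems(2) by blast
  then have "finite (C - {i})" "D \<subseteq> C - {i}" "card (C - {i}) = card D + k"
    using Suc.prems by auto
  from Suc.IH[OF this] obtain Xs where Xs: "length Xs = k" "successively covers ((C - {i}) # Xs)"
    "last ((C - {i}) # Xs) = D" by blast
  then show ?case using i by (intro exI[of _ "(C - {i}) # Xs"]) (auto simp: covers_def)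
qed

text \<open>
  Induction on the length.  If the chains leave \<open>C\<close> through \<open>X = C - {i}\<close> and \<open>Y = C - {j}\<close> with \<open>i \<noteq> j\<close>, both
  are compared with chains through \<open>Z = C - {i, j}\<close>: below \<open>X\<close> and below \<open>Y\<close> by induction, and \<open>C, X, Z, \<dots>\<close>
  with \<open>C, Y, Z, \<dots>\<close> by the quadratic relation.
\<close>

lemma same_top_chains:
  assumes "C \<subseteq> {1..n}" "successively covers (C # Xs)" "successively covers (C # Ys)"
    "length Xs = m" "length Ys = m"
  shows "same_top K n (C # Xs) (C # Ys)"
  using assms
proof (induction m arbitrary: C Xs Ys)
  case (Suc m)
  obtain X Xs' where Xs: "Xs = X # Xs'" using Suc.prems by (cases Xs) auto
  obtain Y Ys' where Ys: "Ys = Y # Ys'" using Suc.prems by (cases Ys) auto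
  obtain i j where ij: "i \<in> C" "X = C - {i}" "j \<in> C" "Y = C - {j}"
    using Suc.prems by (auto simp: Xs Ys covers_def)
  have C: "C \<subseteq> {1..n}" "finite C" using Suc.prems(1) finite_subset by auto
  have XY: "X \<subseteq> {1..n}" "Y \<subseteq> {1..n}" "finite X" using C ij by auto
  have ch: "successively covers (X # Xs')" "successively covers (Y # Ys')" "length Xs' = m" "length Ys' = m"
    using Suc.prems Xs Ys by auto
  have lift: "same_top K n (C # Us) (C # Vs)" if "same_top K n Us Vs" for Us Vs
    using same_top_context[OF that, of "[C]" "[]"] C by simp
  show ?case
  proof (cases "X = Y")
    case True
    then show ?thesis using lift[OF Suc.IH[OF XY(1) ch(1), of Ys']] ch Xs Ys by simp
  next
    case False
    show ?thesis
    proof (cases m)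
      case 0
      then show ?thesis using same_top_pair[OF C(1) ij(1,3)] Xs Ys ch ij by simp
    next
      case (Suc m')
      let ?Z = "C - {i, j}"
      have Z: "covers X ?Z" "covers Y ?Z" "?Z \<subseteq> {1..n}" "finite ?Z" "card X = Suc (card ?Z)"
      proof -
        have "?Z = X - {j}" "?Z = Y - {i}" "j \<in> X" "i \<in> Y" using ij False by auto
        then show "covers X ?Z" "covers Y ?Z" "card X = Suc (card ?Z)"
          using XY(3) unfolding covers_def by (blast, blast, metis card_Suc_Diff1)
      qed (use C in auto)
      \<comment> \<open>Any chain from \<open>Z\<close> will do; it may reach the empty set.\<close>
      define W where "W = block_sets (?Z, m)"
      have "m \<le> card X" using successively_covers_length[OF XY(3) ch(1)] ch(3) by simp
      then have W: "successively covers W" "length W = m" "hd W = ?Z" "W \<noteq> []"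
        using successively_block_sets[OF Z(4), of m'] Suc Z(5)
        by (simp_all add: W_def) (simp_all add: block_sets_def upt_conv_Cons del: upt_Suc)
      then have WX: "successively covers (X # W)" "successively covers (Y # W)"
        using Z by (cases W; simp)+
      have WZ: "set W \<subseteq> Pow {1..n}"
      proof -
        obtain W' where W': "W = ?Z # W'" using W(3,4) by (cases W) simp_all
        then have "set W' \<subseteq> Pow ?Z" using W(1) by (intro successively_covers_subset) simp
        then show ?thesis using Z(3) unfolding W' by auto
      qed
      have "same_top K n (C # X # Xs') (C # X # W)"
        by (intro lift Suc.IH) (use XY ch W WX in auto)
      also have "same_top K n (C # X # W) (C # Y # W)"
        using same_top_context[OF same_top_pair[OF C(1) ij(1,3)], of "[]" W] WZ ij by simp
      also have "same_top K n (C # Y # W) (C # Y # Ys')"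
        by (intro lift Suc.IH) (use XY ch W WX in auto)
      finally show ?thesis by (simp add: Xs Ys)
    qed
  qed
qed simp

text \<open>
  The chain inside the block need not pass above \<open>D\<close>.  It is first exchanged for one that does, so
  that \<open>D\<close> completes it to a longer chain, which is then exchanged for the standard one.
\<close>

lemma same_top_extend_block:
  assumes v: "v \<subseteq> {1..n}" and c: "continues (v, Suc k) D"
  shows "same_top K n (block_sets (v, Suc k) @ [D]) (block_sets (v, Suc (Suc k)))"
proof -
  have v': "finite v" "D \<subseteq> v" "card v = card D + Suc k" using c by (auto simp: continues_def)
  obtain Xs where Xs: "length Xs = Suc k" "successively covers (v # Xs)" "last (v # Xs) = D"
    using exists_chain[OF v'] by blast
  then have e: "v # Xs = (v # butlast Xs) @ [D]" "Xs \<noteq> []"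
    using append_butlast_last_id[of "Xs"] by auto
  have b: "successively covers (v # butlast Xs)"
    using Xs(2) unfolding e(1) by (simp add: successively_append_iff del: append_Cons)
  have "same_top K n (block_sets (v, Suc k)) (v # butlast Xs)"
    unfolding block_sets_Suc_left
    by (rule same_top_chains[OF v])
      (use successively_block_sets[OF v'(1), of k] v' b Xs(1) in \<open>simp_all add: block_sets_Suc_left\<close>, simp add: block_sets_def)
  from same_top_context[OF this, of "[]" "[D]"]
  have "same_top K n (block_sets (v, Suc k) @ [D]) (v # Xs)"
    using v v' e by auto
  also have "same_top K n (v # Xs) (block_sets (v, Suc (Suc k)))"
    unfolding block_sets_Suc_left[of v "Suc k"]
    by (rule same_top_chains[OF v])
      (use successively_block_sets[OF v'(1), of "Suc k"] v' Xs in \<open>simp_all add: block_sets_Suc_left[of v "Suc k"]\<close>, simp add: block_sets_def)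
  finally show ?thesis .
qed

lemma same_top_standardize:
  assumes "is_string n Bs"
  shows "same_top K n Bs (concat_blocks (blocks Bs))"
  using assms
proof (induction Bs rule: rev_induct)
  case (snoc D Bs)
  then have Bs: "is_string n Bs" "D \<subseteq> {1..n}" by (auto simp: is_string_def)
  have std: "is_string n (concat_blocks (blocks Bs))" by (rule standardize(1)[OF Bs(1)])
  have 1: "same_top K n (Bs @ [D]) (concat_blocks (blocks Bs) @ [D])"
    using same_top_context[OF snoc.IH[OF Bs(1)], of "[]" "[D]"] Bs(2) by simp
  show ?case
  proof (cases "Bs = []")
    case True
    then show ?thesis by (simp add: block_sets_def)
  next
    case False
    then obtain v k s where b: "blocks Bs = (v, Suc k) # s" using blocks_nonempty by blast
    show ?thesis
    proof (cases "continues (v, Suc k) D")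
      case True
      have sub: "set (concat_blocks s) \<subseteq> Pow {1..n}" "v \<subseteq> {1..n}"
        using std by (auto simp: b is_string_def block_sets_Suc_left)
      have "same_top K n (concat_blocks s @ (block_sets (v, Suc k) @ [D]) @ [])
          (concat_blocks s @ block_sets (v, Suc (Suc k)) @ [])"
        by (intro same_top_context same_top_extend_block sub True) simp
      with 1 show ?thesis using True by (auto simp: b intro: same_top_trans)
    next
      case new: False
      then show ?thesis using 1 by (simp add: b block_sets_def[of "(D, Suc 0)"])
    qed
  qed
qed simp

definition std_span :: "nat \<Rightarrow> ('k::field) free set" where
  "std_span n = free.span (free_r_str ` std_strings n \<union> Q_ideal n)"

lemma free_r_str_in_std_span:
  "set Bs \<subseteq> Pow {1..n} \<Longrightarrow> (free_r_str Bs :: ('k::field) free) \<in> std_span n"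
proof (induction "str_weight Bs" arbitrary: Bs rule: less_induct)
  case less
  have low: "low n (str_weight Bs) \<subseteq> (std_span n :: 'k free set)"
    unfolding low_def
  proof (rule free.span_minimal)
    show "free_r_str ` {Cs. set Cs \<subseteq> Pow {1..n} \<and> str_weight Cs < str_weight Bs} \<union> Q_ideal n \<subseteq> (std_span n :: 'k free set)"
      using less.hyps by (auto simp: std_span_def intro: free.span_base)
    show "free.subspace (std_span n :: 'k free set)"
      by (simp add: std_span_def free.subspace_span)
  qed
  show ?case
  proof (cases "{} \<in> set Bs")
    case True
    then obtain Us Vs where "Bs = Us @ {} # Vs" by (meson split_list)
    then show ?thesis by (simp add: std_span_def free.span_zero)
  next
    case False
    then have str: "is_string n Bs" using less.prems by (auto simp: is_string_def)
    let ?Cs = "concat_blocks (blocks Bs)"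
    have "free_r_str Bs - free_r_str ?Cs \<in> (std_span n :: 'k free set)"
      using same_top_standardize[OF str, of "TYPE('k)"] low by (auto simp: same_top_def)
    moreover have "free_r_str ?Cs \<in> (std_span n :: 'k free set)"
      unfolding std_span_def
      by (rule free.span_base) (use standardize[OF str] in \<open>auto simp: std_strings_eq\<close>)
    ultimately show ?thesis
      unfolding std_span_def using free.span_add by fastforce
  qed
qed

section \<open>Standard strings form a basis\<close>

lemma free_alg_in_std_span:
  fixes p :: "('k::field) free"
  assumes "p \<in> carrier (free_alg n)"
  shows "p \<in> std_span n"
proof -
  have sub: "free.subspace (std_span n :: 'k free set)"
    by (simp add: std_span_def free.subspace_span)
  have ideal: "x \<in> std_span n" if "x \<in> Q_ideal n" for x :: "'k free"
    unfolding std_span_def by (rule free.span_base) (use that in blast)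
  have gen: "zfree A i * q \<in> std_span n"
    if g: "(A, i) \<in> gens n" and q: "q \<in> std_span n" for A i and q :: "'k free"
    using q unfolding std_span_def
  proof (induction q rule: free.span_induct)
    case base
    show ?case
      unfolding free.subspace_def
    proof (intro conjI ballI allI, goal_cases)
      case 1
      then show ?case by (simp add: free.span_zero)
    next
      case (2 x y)
      then show ?case by (simp add: distrib_left free.span_add)
    next
      case (3 c x)
      have "zfree A i * (const_free c * x) = const_free c * (zfree A i * x)"
        by (simp add: const_free_central[of c "zfree A i"] flip: mult.assoc)
      then show ?case using 3 by (simp add: free.span_scale)
    qed
  next
    case (step x)
    then show ?case
    proof
      assume "x \<in> free_r_str ` std_strings n"
      then obtain Bs where x: "x = free_r_str Bs" and "is_string n Bs" by (auto simp: std_strings_def)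
      then have Bs: "set Bs \<subseteq> Pow {1..n}" by (auto simp: is_string_def)
      have A: "A \<subseteq> {1..n}" "i \<in> {1..n}" "i \<notin> A" using g by (auto simp: gens_def)
      have "(zfree A i - (free_r (insert i A) - free_r A)) * x \<in> std_span n"
        unfolding x by (intro ideal Q_ideal_closed(5) zfree_cong_free_r A free_r_str_closed Bs)
      moreover have "free_r_str (insert i A # Bs) \<in> (std_span n :: 'k free set)"
        "free_r_str (A # Bs) \<in> (std_span n :: 'k free set)"
        using A Bs by (intro free_r_str_in_std_span; simp)+
      ultimately have "(zfree A i - (free_r (insert i A) - free_r A)) * x
          + (free_r_str (insert i A # Bs) - free_r_str (A # Bs)) \<in> std_span n"
        using sub by (intro free.subspace_add free.subspace_diff)
      then show ?thesis unfolding std_span_def[symmetric] by (simp add: x algebra_simps)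
    next
      assume "x \<in> Q_ideal n"
      then show ?thesis
        unfolding std_span_def[symmetric] by (intro ideal Q_ideal_closed(4) zfree_closed g)
    qed
  qed
  have word: "Poly_Mapping.single (Fword gs) 1 \<in> (std_span n :: 'k free set)" if "set gs \<subseteq> gens n" for gs
    using that
  proof (induction gs)
    case Nil
    have "free_r_str [] \<in> (std_span n :: 'k free set)" by (rule free_r_str_in_std_span) simp
    then show ?case by (simp flip: zero_fword_def)
  next
    case (Cons g gs)
    have "Poly_Mapping.single (Fword (g # gs)) (1 :: 'k) = zfree (fst g) (snd g) * Poly_Mapping.single (Fword gs) 1"
      by (simp add: zfree_def mult_single plus_fword_def)
    then show ?case using Cons gen[of "fst g" "snd g" "Poly_Mapping.single (Fword gs) 1"] by simp
  qed
  have "p = (\<Sum>w\<in>Poly_Mapping.keys p. const_free (Poly_Mapping.lookup p w) * Poly_Mapping.single w 1)"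
    by (intro poly_mapping_eqI)
      (simp add: const_free_def mult_single lookup_sum lookup_single when_def in_keys_iff)
  also have "\<dots> \<in> std_span n"
  proof (intro free.subspace_sum[OF sub] free.subspace_scale[OF sub])
    fix w assume "w \<in> Poly_Mapping.keys p"
    then show "Poly_Mapping.single w 1 \<in> (std_span n :: 'k free set)"
      using assms word[of "letters w"] by (simp add: free_alg_carrier)
  qed
  finally show ?thesis .
qed

lemma quo_const_mult:
  fixes p :: "('k::field) free"
  assumes "p \<in> carrier (free_alg n)"
  shows "quo n (const_free c * p) = c \<odot>\<^bsub>Q_alg n\<^esub> quo n p"
  using quo_hom(2)[OF const_free_closed assms] by simp

lemma std_string_sets: "Bs \<in> std_strings n \<Longrightarrow> set Bs \<subseteq> Pow {1..n}"
  by (auto simp: std_strings_def is_string_def)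

text \<open>
  Let \<open>M\<close> be a string of maximal weight among those with nonzero coefficient.  Apply the relation to
  the indicator function of the block word of \<open>M\<close> and evaluate at the empty word: among the strings
  of at most this weight only \<open>M\<close> itself has this block word as its leading term, so the
  coefficient of \<open>M\<close> is zero.
\<close>

lemma std_strings_independent:
  fixes c :: "nat set list \<Rightarrow> 'k::field"
  assumes F: "finite F" "F \<subseteq> std_strings n"
    and rel: "(\<Sum>Bs\<in>F. const_free (c Bs) * free_r_str Bs) \<in> Q_ideal n"
    and Bs: "Bs \<in> F"
  shows "c Bs = 0"
proof (rule ccontr)
  assume "c Bs \<noteq> 0"
  define G where "G = {Bs \<in> F. c Bs \<noteq> 0}"
  have G: "finite G" "G \<noteq> {}" using F(1) Bs \<open>c Bs \<noteq> 0\<close> by (auto simp: G_def)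
  obtain M where M: "M \<in> G" "\<And>Cs. Cs \<in> G \<Longrightarrow> str_weight Cs \<le> str_weight M"
  proof -
    have "Max (str_weight ` G) \<in> str_weight ` G" using G by (intro Max_in) auto
    then obtain M where "M \<in> G" "str_weight M = Max (str_weight ` G)" by auto
    with that[of M] show ?thesis using G(1) by simp
  qed
  define \<phi> where "\<phi> = (\<lambda>w. if w = blocks M then 1 else 0 :: 'k)"
  have wt: "word_weight (foldl snoc_set s Cs) = word_weight s + str_weight Cs" for s Cs
    by (induction Cs arbitrary: s) (simp_all add: word_weight_snoc_set)
  have sum: "act_free (\<Sum>Cs\<in>H. f Cs) \<phi> [] = (\<Sum>Cs\<in>H. act_free (f Cs) \<phi> [])" for H and f :: "nat set list \<Rightarrow> 'k free"
    by (induction H rule: infinite_finite_induct) (simp_all add: act_free_add)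
  have val: "c Cs * foldr act_r Cs \<phi> [] = (if Cs = M then c M else 0)" if "Cs \<in> F" for Cs
  proof (cases "c Cs = 0")
    case True
    then show ?thesis using M(1) by (auto simp: G_def)
  next
    case False
    have inF: "Cs \<in> std_strings n" "M \<in> std_strings n" using F(2) that M(1) by (auto simp: G_def)
    have "foldr act_r Cs \<phi> [] = \<phi> (blocks Cs)"
    proof (rule act_r_string_leading)
      show "\<forall>B\<in>set Cs. finite B \<and> B \<noteq> {}"
        using inF(1) finite_subset[of _ "{1..n}"] by (auto simp: std_strings_def is_string_def)
      fix w assume "word_weight w < word_weight [] + (\<Sum>B\<leftarrow>Cs. card B)"
      then have "word_weight w < word_weight (blocks M)"
        using M(2)[of Cs] that False by (simp add: G_def wt str_weight_def)
      then show "\<phi> w = 0" by (auto simp: \<phi>_def)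
    qed
    also have "\<dots> = (if Cs = M then 1 else 0)"
    proof -
      have "concat_blocks (blocks Cs) = Cs" "concat_blocks (blocks M) = M"
        using inF by (simp_all only: std_strings_eq mem_Collect_eq concat_blocks_of_standard)
      then have "blocks Cs = blocks M \<longleftrightarrow> Cs = M" by metis
      then show ?thesis by (simp only: \<phi>_def)
    qed
    finally show ?thesis by simp
  qed
  have fin: "\<forall>B\<in>set Cs. finite B" if "Cs \<in> F" for Cs
  proof
    fix B assume "B \<in> set Cs"
    then have "B \<subseteq> {1..n}" using std_string_sets[of Cs n] that F(2) by auto
    then show "finite B" by (rule finite_subset) simp
  qed
  have "0 = act_free (\<Sum>Cs\<in>F. const_free (c Cs) * free_r_str Cs) \<phi> []"
    using act_free_Q_ideal[OF rel] by simp
  also have "\<dots> = (\<Sum>Cs\<in>F. c Cs * foldr act_r Cs \<phi> [])"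
    unfolding sum by (rule sum.cong) (simp_all add: act_free_mult act_free_const act_free_r_str fin)
  also have "\<dots> = (\<Sum>Cs\<in>F. if Cs = M then c M else 0)"
    using val by (rule sum.cong[OF refl])
  also have "\<dots> = c M" using F(1) M(1) by (simp add: G_def)
  finally show False using M(1) by (simp add: G_def)
qed

theorem theorem1p3p8:
  fixes n :: nat
  assumes "n \<ge> 1"
  shows "vectorspace.basis (class_ring :: 'k::field ring) (Q_alg n) (r_str n ` std_strings n)"
proof -
  let ?Q = "Q_alg n :: ('k, 'k free set) module"
  let ?Y = "r_str n ` std_strings n :: 'k free set set"
  interpret V: vectorspace "class_ring :: 'k ring" ?Q by (rule Q_vectorspace)
  have r: "r_str n Bs = (quo n (free_r_str Bs) :: 'k free set)" if "Bs \<in> std_strings n" for Bs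
    using quo_free_r_str[OF std_string_sets[OF that]] by metis
  have Y: "?Y \<subseteq> carrier ?Q"
    using r quo_closed[OF free_r_str_closed[OF std_string_sets]] by (metis image_subsetI)
  interpret S: submodule "class_ring :: 'k ring" "V.span ?Y" ?Q
    by (rule V.span_is_submodule[OF Y])
  have span: "V.span ?Y = carrier ?Q"
  proof
    show "V.span ?Y \<subseteq> carrier ?Q" using Y by (rule V.span_is_subset2)
    have "p \<in> carrier (free_alg n) \<and> quo n p \<in> V.span ?Y" if "p \<in> std_span n" for p :: "'k free"
      using that unfolding std_span_def
    proof (induction p rule: free.span_induct)
      case base
      show ?case
        unfolding free.subspace_def
      proof (intro conjI ballI allI CollectI, goal_cases)
        case 1
        show ?case by (rule free_alg_0_1)
      next
        case 2
        show ?case unfolding quo_0 by (rule S.zero_closed)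
      next
        case (3 x y)
        then show ?case by (simp add: free_alg_closed)
      next
        case (4 x y)
        then show ?case using quo_hom(1)[of x n y] S.m_closed[of "quo n x" "quo n y"] by simp
      next
        case (5 c x)
        then show ?case by (simp add: free_alg_closed const_free_closed)
      next
        case (6 c x)
        then have "x \<in> carrier (free_alg n)" "quo n x \<in> V.span ?Y" by simp_all
        then show ?case using S.smult_closed[of c "quo n x"] quo_const_mult[of x n c] by simp
      qed
    next
      case (step x)
      then show ?case
      proof
        assume "x \<in> free_r_str ` std_strings n"
        then obtain Bs where Bs: "x = free_r_str Bs" "Bs \<in> std_strings n" by blast
        then have "quo n x \<in> ?Y" using r[OF Bs(2)] by (metis imageI)
        then have "quo n x \<in> V.span ?Y" using V.in_own_span[OF Y] by blast
        then show ?thesis using Bs free_r_str_closed std_string_sets by blast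
      next
        assume x: "x \<in> Q_ideal n"
        then have "quo n x = quo n 0"
          by (intro quot_eqI Q_ideal_closed(1) free_alg_0_1) simp_all
        then have "quo n x \<in> V.span ?Y" unfolding quo_0 using S.zero_closed by metis
        then show ?thesis using Q_ideal_closed(1)[OF x] by blast
      qed
    qed
    then show "carrier ?Q \<subseteq> V.span ?Y"
      using free_alg_in_std_span by (auto simp: Q_ring_carrier)
  qed
  have indpt: "V.lin_indpt ?Y"
  proof
    assume "V.lin_dep ?Y"
    then obtain A a v where A: "finite A" "A \<subseteq> ?Y" "V.lincomb a A = \<zero>\<^bsub>?Q\<^esub>" "v \<in> A"
      and av: "a v \<noteq> \<zero>\<^bsub>class_ring\<^esub>"
      unfolding V.lin_dep_def by blast
    from A(2) have "\<forall>x\<in>A. \<exists>Bs. Bs \<in> std_strings n \<and> x = r_str n Bs" by blast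
    then obtain B where B: "\<And>x. x \<in> A \<Longrightarrow> B x \<in> std_strings n" "\<And>x. x \<in> A \<Longrightarrow> x = r_str n (B x)"
      by metis
    \<comment> \<open>The elements of \<open>A\<close> are images of strings; the strings chosen for them are distinct.\<close>
    have inj: "inj_on B A" using B(2) by (metis inj_onI)
    let ?f = "\<lambda>x. const_free (a x) * free_r_str (B x)"
    have f: "?f x \<in> carrier (free_alg n)" if "x \<in> A" for x
      using B(1)[OF that] by (intro free_alg_closed const_free_closed free_r_str_closed std_string_sets)
    have q: "quo n (?f x) = a x \<odot>\<^bsub>?Q\<^esub> x" if "x \<in> A" for x
    proof -
      have "quo n (?f x) = a x \<odot>\<^bsub>?Q\<^esub> quo n (free_r_str (B x))"
        by (rule quo_const_mult[OF free_r_str_closed[OF std_string_sets[OF B(1)[OF that]]]])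
      also have "quo n (free_r_str (B x)) = x"
        using r[OF B(1)[OF that]] B(2)[OF that] by metis
      finally show ?thesis .
    qed
    have "quo n (sum ?f A) = (\<Oplus>\<^bsub>?Q\<^esub> x \<in> A. quo n (?f x))"
      by (rule quo_sum[OF A(1) f])
    also have "\<dots> = V.lincomb a A"
      unfolding V.lincomb_def
      by (rule V.finsum_cong'[OF refl]) (use q quo_closed[OF f] in \<open>auto simp del: Q_simps\<close>)
    also have "\<dots> = quo n 0" unfolding quo_0 by (rule A(3))
    finally have "quo n (sum ?f A) = quo n 0" .
    then have "sum ?f A - 0 \<in> Q_ideal n" by (intro quo_eqD free_alg_sum f)
    moreover have "sum ?f A = (\<Sum>Bs\<in>B ` A. const_free (a (r_str n Bs)) * free_r_str Bs)"
      unfolding sum.reindex[OF inj] o_def by (rule sum.cong[OF refl]) (use B(2) in simp)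
    ultimately have "a (r_str n (B v)) = 0"
      using std_strings_independent[of "B ` A" n "\<lambda>Bs. a (r_str n Bs)" "B v"] A B(1) by auto
    then show False using av B(2)[OF A(4)] by simp
  qed
  show ?thesis
    unfolding V.basis_def using Y span indpt by blast
qed

end
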